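(* There is an algorithm that solves the Diophantine problem over the lamplighter group $L_2$ in time $O(|W|^k)$ for quadratic equations $W=1$ of the following types: (1) $\prod_{j=1}^k z_j^{-1}c_jz_j=1$ with $k\ge1$; (2) $\prod_{i=1}^g[x_i,y_i]\prod_{j=1}^k z_j^{-1}c_jz_j=1$ with $g\ge1$, $k\ge0$; (3) $\prod_{i=1}^g x_i^2\prod_{j=1}^k z_j^{-1}c_jz_j=1$ with $g\ge1$, $k\ge0$. Here $x_i,y_i,z_j$ are variables and the $c_j\in L_2$ are given constants; that is, the algorithm decides whether the given equation has a solution with all variables taking values in $L_2$.
   Context: Let $\mathbb{Z}_2^{\mathbb{Z}}$ denote the abelian group of finitely supported functions $f:\mathbb{Z}\to\mathbb{Z}_2$ under pointwise addition, and for $b\in\mathbb{Z}$ put $f^b(x)=f(x+b)$. The lamplighter group is $L_2=\mathbb{Z}\ltimes\mathbb{Z}_2^{\mathbb{Z}}$, the set of pairs $(\delta,f)$ with product $(\delta_1,f_1)(\delta_2,f_2)=(\delta_1+\delta_2,\,f_1^{\delta_2}+f_2)$. It is generated by $a=(0,\mathbf 1_0)$, where $\mathbf 1_0$ is the indicator function of $\{0\}$, and $t=(1,0)$; elements of $L_2$ are given as words in $a^{\pm1},t^{\pm1}$. The size of an equation $W=1$ is the length $|W|$ of its left-hand side (with constants written as words in $a^{\pm1},t^{\pm1}$). The model of computation is a random-access machine. *)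

theory Defs
  imports Complex_Main "HOL-Library.Z2" "HOL-Algebra.Group"
begin

section \<open>The lamplighter group\<close>

definition shift :: "int \<Rightarrow> (int \<Rightarrow> bit) \<Rightarrow> int \<Rightarrow> bit" where
  "shift b f = (\<lambda>x. f (x + b))"

definition L2 :: "(int \<times> (int \<Rightarrow> bit)) monoid" where
  "L2 = \<lparr>carrier = {(d, f) |d f. finite {x. f x \<noteq> 0}},
         mult = (\<lambda>(d1, f1) (d2, f2). (d1 + d2, \<lambda>x. shift d2 f1 x + f2 x)),
         one = (0, \<lambda>_. 0)\<rparr>"

lemma finite_support_shift:
  assumes "finite {x. f x \<noteq> (0::bit)}"
  shows "finite {x. shift b f x \<noteq> 0}"
proof -
  have "{x. shift b f x \<noteq> 0} \<subseteq> (\<lambda>x. x - b) ` {x. f x \<noteq> 0}"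
  proof
    fix x assume "x \<in> {x. shift b f x \<noteq> 0}"
    then show "x \<in> (\<lambda>x. x - b) ` {x. f x \<noteq> 0}"
      by (intro image_eqI[of _ _ "x + b"]) (auto simp: shift_def)
  qed
  then show ?thesis
    using assms finite_surj by blast
qed

lemma finite_support_add:
  assumes "finite {x. f x \<noteq> (0::bit)}" "finite {x. g x \<noteq> (0::bit)}"
  shows "finite {x. f x + g x \<noteq> 0}"
  by (rule finite_subset[of _ "{x. f x \<noteq> 0} \<union> {x. g x \<noteq> 0}"]) (use assms in auto)

lemma group_L2: "group L2"
proof (rule groupI)
  fix x y assume "x \<in> carrier L2" "y \<in> carrier L2"
  then obtain d1 f1 d2 f2 where xy: "x = (d1, f1)" "y = (d2, f2)"
    and fin: "finite {u. f1 u \<noteq> 0}" "finite {u. f2 u \<noteq> 0}"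
    unfolding L2_def by fastforce
  show "x \<otimes>\<^bsub>L2\<^esub> y \<in> carrier L2"
    using finite_support_add[OF finite_support_shift[OF fin(1)] fin(2)]
    by (simp add: L2_def xy)
next
  show "\<one>\<^bsub>L2\<^esub> \<in> carrier L2"
    by (simp add: L2_def)
next
  fix x y z assume "x \<in> carrier L2" "y \<in> carrier L2" "z \<in> carrier L2"
  then show "x \<otimes>\<^bsub>L2\<^esub> y \<otimes>\<^bsub>L2\<^esub> z = x \<otimes>\<^bsub>L2\<^esub> (y \<otimes>\<^bsub>L2\<^esub> z)"
    by (cases x; cases y; cases z) (simp add: L2_def shift_def add.assoc add.commute add.left_commute
        del: add_bit_eq_xor)
next
  fix x assume "x \<in> carrier L2"
  then show "\<one>\<^bsub>L2\<^esub> \<otimes>\<^bsub>L2\<^esub> x = x"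
    by (auto simp: L2_def shift_def)
next
  fix x assume "x \<in> carrier L2"
  then obtain d f where x: "x = (d, f)" and f: "finite {y. f y \<noteq> 0}"
    by (auto simp: L2_def)
  show "\<exists>y\<in>carrier L2. y \<otimes>\<^bsub>L2\<^esub> x = \<one>\<^bsub>L2\<^esub>"
  proof (rule bexI[of _ "(- d, shift (- d) f)"])
    show "(- d, shift (- d) f) \<otimes>\<^bsub>L2\<^esub> x = \<one>\<^bsub>L2\<^esub>"
      by (auto simp: x L2_def shift_def)
    show "(- d, shift (- d) f) \<in> carrier L2"
      using finite_support_shift[OF f] by (simp add: L2_def)
  qed
qed

section \<open>Equations\<close>

datatype gen = GenA | GenT

datatype var = VarX nat | VarY nat | VarZ nat

datatype sym = Gen gen | Var var

datatype 's letter = Pos 's | Inv 's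

fun gen_elem :: "gen \<Rightarrow> int \<times> (int \<Rightarrow> bit)" where
  "gen_elem GenA = (0, \<lambda>x. if x = 0 then 1 else 0)"
| "gen_elem GenT = (1, \<lambda>_. 0)"

fun sym_value :: "(var \<Rightarrow> int \<times> (int \<Rightarrow> bit)) \<Rightarrow> sym \<Rightarrow> int \<times> (int \<Rightarrow> bit)" where
  "sym_value \<sigma> (Gen s) = gen_elem s"
| "sym_value \<sigma> (Var v) = \<sigma> v"

fun letter_value ::
  "(var \<Rightarrow> int \<times> (int \<Rightarrow> bit)) \<Rightarrow> sym letter \<Rightarrow> int \<times> (int \<Rightarrow> bit)" where
  "letter_value \<sigma> (Pos s) = sym_value \<sigma> s"
| "letter_value \<sigma> (Inv s) = inv\<^bsub>L2\<^esub> (sym_value \<sigma> s)"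

fun word_value ::
  "(var \<Rightarrow> int \<times> (int \<Rightarrow> bit)) \<Rightarrow> sym letter list \<Rightarrow> int \<times> (int \<Rightarrow> bit)" where
  "word_value \<sigma> [] = \<one>\<^bsub>L2\<^esub>"
| "word_value \<sigma> (l # w) = letter_value \<sigma> l \<otimes>\<^bsub>L2\<^esub> word_value \<sigma> w"

definition solvable :: "sym letter list \<Rightarrow> bool" where
  "solvable W \<longleftrightarrow> (\<exists>\<sigma>. (\<forall>v. \<sigma> v \<in> carrier L2) \<and> word_value \<sigma> W = \<one>\<^bsub>L2\<^esub>)"

definition comm_word :: "nat \<Rightarrow> sym letter list" where
  "comm_word i = [Inv (Var (VarX i)), Inv (Var (VarY i)), Pos (Var (VarX i)), Pos (Var (VarY i))]"

definition square_word :: "nat \<Rightarrow> sym letter list" where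
  "square_word i = [Pos (Var (VarX i)), Pos (Var (VarX i))]"

definition conj_word :: "nat \<Rightarrow> gen letter list \<Rightarrow> sym letter list" where
  "conj_word j c = [Inv (Var (VarZ j))] @ map (map_letter Gen) c @ [Pos (Var (VarZ j))]"

definition comm_prod :: "nat \<Rightarrow> sym letter list" where
  "comm_prod g = concat (map comm_word [1..<Suc g])"

definition square_prod :: "nat \<Rightarrow> sym letter list" where
  "square_prod g = concat (map square_word [1..<Suc g])"

definition conj_prod :: "gen letter list list \<Rightarrow> sym letter list" where
  "conj_prod cs = concat (map2 conj_word [1..<Suc (length cs)] cs)"

text \<open>
  \<open>quadratic_lhs W k\<close>: \<open>W\<close> is the left-hand side of an equation of one of the three types,
  with exactly \<open>k\<close> constants \<open>c\<^sub>1, \<dots>, c\<^sub>k\<close>.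
\<close>

inductive quadratic_lhs :: "sym letter list \<Rightarrow> nat \<Rightarrow> bool" where
  spherical: "length cs = k \<Longrightarrow> k \<ge> 1 \<Longrightarrow> quadratic_lhs (conj_prod cs) k"
| orientable: "length cs = k \<Longrightarrow> g \<ge> 1 \<Longrightarrow> quadratic_lhs (comm_prod g @ conj_prod cs) k"
| nonorientable: "length cs = k \<Longrightarrow> g \<ge> 1 \<Longrightarrow> quadratic_lhs (square_prod g @ conj_prod cs) k"

section \<open>Random-access machines\<close>

text \<open>
  A unit-cost random-access machine with addition and truncated subtraction.  Registers are
  indexed by the natural numbers, hold natural numbers, and are initially zero.  The input is a
  finite sequence of numbers in a separate read-only store with random access.  Jump targets are
  positions in the program; the machine halts when the program counter leaves the program.
\<close>

datatype instr =
    SetConst nat nat      \<comment> \<open>\<open>R\<^sub>i := n\<close>\<close>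
  | Add nat nat nat       \<comment> \<open>\<open>R\<^sub>i := R\<^sub>j + R\<^sub>l\<close>\<close>
  | Sub nat nat nat       \<comment> \<open>\<open>R\<^sub>i := max(R\<^sub>j - R\<^sub>l, 0)\<close>\<close>
  | Load nat nat          \<comment> \<open>\<open>R\<^sub>i := R[R\<^sub>j]\<close>\<close>
  | Store nat nat         \<comment> \<open>\<open>R[R\<^sub>i] := R\<^sub>j\<close>\<close>
  | InLength nat          \<comment> \<open>\<open>R\<^sub>i :=\<close> length of the input\<close>
  | InRead nat nat        \<comment> \<open>\<open>R\<^sub>i := input[R\<^sub>j]\<close>, counted from 0, and 0 beyond the end\<close>
  | JumpZero nat nat      \<comment> \<open>if \<open>R\<^sub>i = 0\<close> then go to position \<open>p\<close>\<close>

type_synonym config = "nat \<times> (nat \<Rightarrow> nat)"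

fun exec_instr :: "nat list \<Rightarrow> instr \<Rightarrow> config \<Rightarrow> config" where
  "exec_instr xs (SetConst i n) (pc, R) = (Suc pc, R(i := n))"
| "exec_instr xs (Add i j l) (pc, R) = (Suc pc, R(i := R j + R l))"
| "exec_instr xs (Sub i j l) (pc, R) = (Suc pc, R(i := R j - R l))"
| "exec_instr xs (Load i j) (pc, R) = (Suc pc, R(i := R (R j)))"
| "exec_instr xs (Store i j) (pc, R) = (Suc pc, R(R i := R j))"
| "exec_instr xs (InLength i) (pc, R) = (Suc pc, R(i := length xs))"
| "exec_instr xs (InRead i j) (pc, R) =
     (Suc pc, R(i := (if R j < length xs then xs ! R j else 0)))"
| "exec_instr xs (JumpZero i p) (pc, R) = (if R i = 0 then p else Suc pc, R)"

definition halted :: "instr list \<Rightarrow> config \<Rightarrow> bool" where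
  "halted P c \<longleftrightarrow> fst c \<ge> length P"

definition step :: "instr list \<Rightarrow> nat list \<Rightarrow> config \<Rightarrow> config" where
  "step P xs c = (if halted P c then c else exec_instr xs (P ! fst c) c)"

definition run :: "instr list \<Rightarrow> nat list \<Rightarrow> nat \<Rightarrow> config" where
  "run P xs n = (step P xs ^^ n) (0, \<lambda>_. 0)"

text \<open>The answer of a halted machine is in register 0: 1 for yes, 0 for no.\<close>

definition answers_within :: "instr list \<Rightarrow> nat list \<Rightarrow> nat \<Rightarrow> bool \<Rightarrow> bool" where
  "answers_within P xs t b \<longleftrightarrow>
     (\<exists>n\<le>t. halted P (run P xs n) \<and> snd (run P xs n) 0 = (if b then 1 else 0))"

text \<open>
  The input of the machine is the word itself, every letter taking two input cells: one for the
  kind of the letter and its sign, one for the index of the variable (0 for \<open>a\<close> and \<open>t\<close>).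
\<close>

fun sym_kind :: "sym \<Rightarrow> nat" where
  "sym_kind (Gen GenA) = 0"
| "sym_kind (Gen GenT) = 1"
| "sym_kind (Var (VarX i)) = 2"
| "sym_kind (Var (VarY i)) = 3"
| "sym_kind (Var (VarZ i)) = 4"

fun sym_index :: "sym \<Rightarrow> nat" where
  "sym_index (Gen s) = 0"
| "sym_index (Var (VarX i)) = i"
| "sym_index (Var (VarY i)) = i"
| "sym_index (Var (VarZ i)) = i"

fun encode_letter :: "sym letter \<Rightarrow> nat list" where
  "encode_letter (Pos s) = [2 * sym_kind s, sym_index s]"
| "encode_letter (Inv s) = [2 * sym_kind s + 1, sym_index s]"

definition encode :: "sym letter list \<Rightarrow> nat list" where
  "encode W = concat (map encode_letter W)"

end

theory Submission
  imports Defs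
begin

text \<open>
  Let \<open>bdry n\<close> be the set of all \<open>h + h\<^sup>n\<close>.  A conjugate of \<open>(\<delta>, f)\<close> is \<open>(\<delta>, f\<^sup>e + u)\<close> with arbitrary
  \<open>e\<close> and \<open>u \<in> bdry \<delta>\<close>; a product of commutators is \<open>(0, u)\<close> with arbitrary \<open>u \<in> bdry 1\<close>; a product
  of squares is \<open>(2 d, u)\<close> with \<open>u \<in> bdry d\<close> for one square and \<open>u \<in> bdry 1\<close> for several.  As
  \<open>bdry a + bdry b = bdry (gcd a b)\<close>, the equation becomes a condition on the sum of the \<open>\<delta>\<^sub>j\<close>, which
  also determines \<open>d\<close>, together with the existence of translates of the \<open>f\<^sub>j\<close> whose sum lies in \<open>bdry n\<close>
  for a gcd \<open>n\<close>.  If \<open>n > 0\<close>, this means that the translates cancel on the circle of length \<open>n\<close>.  If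
  \<open>n = 0\<close>, they must cancel on the line, but a circle of length \<open>|W|\<close> serves as well: the supports
  are too short to cover it, so it can be cut open at a point that they avoid.  Only residues modulo
  \<open>n \<le> |W|\<close> matter and one translate can be fixed, so at most \<open>|W|\<^sup>k\<^sup>-\<^sup>1\<close> choices remain, each of
  which is tested by one walk along \<open>W\<close>.
\<close>

section \<open>Boundaries of lamp configurations\<close>

text \<open>The order of quantifiers shapes the program: one machine and one factor \<open>C\<close>
  serve all \<open>k\<close>, so each of the at most \<open>|W|^(k-1)\<close> choices may cost only
  a multiple of \<open>|W|\<close> that does not grow with \<open>k\<close>. Hence there is no nest
  of loops over the conjugators, and the machine never learns \<open>k\<close>: a counter in base
  \<open>n\<close> is advanced while the word is being walked, and a carry out of the last block
  tells that all choices were tried. Two small cases set further limits. For \<open>k = 1\<close>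
  everything, gcds included, must be linear on a machine without division, so Euclid by subtraction
  is charged to a potential carried along the whole word. For \<open>k = 0\<close> the bound is
  constant and there is no time to read the word: the answer must come from its last letter.\<close>

declare add_bit_eq_xor [simp del]

lemma bit_add_self [simp]: "(b::bit) + b = 0" "(b::bit) + (b + c) = c"
  by (cases b; cases c; simp)+

lemma bit_add_eq_0_iff: "(b::bit) + c = 0 \<longleftrightarrow> b = c"
  by (cases b; cases c; simp)

definition fin_supp :: "(int \<Rightarrow> bit) \<Rightarrow> bool" where
  "fin_supp f \<longleftrightarrow> finite {x. f x \<noteq> 0}"

lemma fin_supp_zero [simp]: "fin_supp (\<lambda>_. 0)"
  by (simp add: fin_supp_def)

lemma fin_supp_add [simp]: "fin_supp f \<Longrightarrow> fin_supp g \<Longrightarrow> fin_supp (\<lambda>x. f x + g x)"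
  unfolding fin_supp_def by (rule finite_support_add)

lemma fin_supp_shift [simp]: "fin_supp f \<Longrightarrow> fin_supp (\<lambda>x. f (x + b))"
  unfolding fin_supp_def by (drule finite_support_shift[of _ b]) (simp add: shift_def)

lemma fin_supp_shift_minus [simp]: "fin_supp f \<Longrightarrow> fin_supp (\<lambda>x. f (x - b))"
  using fin_supp_shift[of f "- b"] by simp

text \<open>With \<open>f\<close> read as a Laurent polynomial over the field of two elements,
  \<open>bdry a\<close> is the ideal generated by \<open>1 + X^a\<close>. The lemmas that follow are
  ideal laws and the effect of divisibility and gcd of exponents.\<close>

definition bdry :: "int \<Rightarrow> (int \<Rightarrow> bit) set" where
  "bdry a = {\<lambda>x. h x + h (x + a) |h. fin_supp h}"

lemma bdryI: "fin_supp h \<Longrightarrow> (\<And>x. F x = h x + h (x + a)) \<Longrightarrow> F \<in> bdry a"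
  by (auto simp: bdry_def fun_eq_iff)

lemma bdryE:
  assumes "F \<in> bdry a"
  obtains h where "fin_supp h" "F = (\<lambda>x. h x + h (x + a))"
  using assms by (auto simp: bdry_def)

lemma bdry_0 [simp]: "F \<in> bdry 0 \<longleftrightarrow> F = (\<lambda>_. 0)"
  by (auto elim!: bdryE intro!: bdryI[of "\<lambda>_. 0"])

lemma bdry_zero [simp]: "(\<lambda>_. 0) \<in> bdry a"
  by (rule bdryI[of "\<lambda>_. 0"]) auto

lemma bdry_add:
  assumes "F \<in> bdry a" "G \<in> bdry a"
  shows "(\<lambda>x. F x + G x) \<in> bdry a"
proof -
  obtain h where h: "fin_supp h" "F = (\<lambda>x. h x + h (x + a))" by (rule bdryE[OF assms(1)])
  obtain g where g: "fin_supp g" "G = (\<lambda>x. g x + g (x + a))" by (rule bdryE[OF assms(2)])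
  show ?thesis
    by (rule bdryI[of "\<lambda>x. h x + g x"]) (use h g in \<open>auto simp: add_ac\<close>)
qed

lemma bdry_shift:
  assumes "F \<in> bdry a"
  shows "(\<lambda>x. F (x + b)) \<in> bdry a"
proof -
  obtain h where h: "fin_supp h" "F = (\<lambda>x. h x + h (x + a))" by (rule bdryE[OF assms(1)])
  show ?thesis
    by (rule bdryI[of "\<lambda>x. h (x + b)"]) (use h in \<open>auto simp: add_ac\<close>)
qed

lemma bdry_cong_add:
  assumes "(\<lambda>x. F x + G x) \<in> bdry a"
  shows "F \<in> bdry a \<longleftrightarrow> G \<in> bdry a"
  using bdry_add[OF assms, of F] bdry_add[OF assms, of G] by (auto simp: add_ac)

lemma bdry_minus [simp]: "bdry (- a) = bdry a"
proof -
  have "bdry a \<subseteq> bdry (- a)" for a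
  proof
    fix F assume "F \<in> bdry a"
    then obtain h where h: "fin_supp h" "F = (\<lambda>x. h x + h (x + a))" by (rule bdryE)
    show "F \<in> bdry (- a)"
      by (rule bdryI[of "\<lambda>x. h (x + a)"]) (use h in \<open>auto simp: add_ac\<close>)
  qed
  from this[of a] this[of "- a"] show ?thesis by auto
qed

text \<open>Telescoping: the sum of the boundaries of the translates of \<open>h\<close> by
  \<open>0, a, ..., (m - 1) a\<close>.\<close>

lemma bdry_multiple_nat:
  assumes "fin_supp h"
  shows "(\<lambda>x. h x + h (x + a * int m)) \<in> bdry a"
proof (induction m)
  case (Suc m)
  have "(\<lambda>x. h (x + a * int m) + h (x + a * int m + a)) \<in> bdry a"
    by (rule bdryI[of "\<lambda>x. h (x + a * int m)"]) (use assms in \<open>auto simp: add_ac\<close>)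
  from bdry_add[OF Suc this] show ?case
    by (simp add: add_ac algebra_simps)
qed auto

lemma bdry_mono:
  assumes "a dvd b"
  shows "bdry b \<subseteq> bdry a"
proof
  fix F assume "F \<in> bdry b"
  then obtain h where h: "fin_supp h" "F = (\<lambda>x. h x + h (x + b))" by (rule bdryE)
  obtain m where m: "b = a * m" using assms by auto
  show "F \<in> bdry a"
  proof (cases "m \<ge> 0")
    case True
    then show ?thesis using bdry_multiple_nat[OF h(1), of a "nat m"] h m by simp
  next
    case False
    then show ?thesis using bdry_multiple_nat[OF h(1), of "- a" "nat (- m)"] h m by simp
  qed
qed

lemma bdry_shift_multiple:
  assumes "fin_supp h" "a dvd b"
  shows "(\<lambda>x. h x + h (x + b)) \<in> bdry a"
  using bdry_mono[OF assms(2)] bdryI[of h "\<lambda>x. h x + h (x + b)" b] assms(1) by auto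

text \<open>Bezout in the exponents. This identity merges the freedom left by several conjugators
  into a single modulus.\<close>

lemma bdry_gcd:
  "F \<in> bdry (gcd a b) \<longleftrightarrow> (\<exists>G\<in>bdry a. \<exists>H\<in>bdry b. F = (\<lambda>x. G x + H x))"
proof
  assume "F \<in> bdry (gcd a b)"
  then obtain h where h: "fin_supp h" "F = (\<lambda>x. h x + h (x + gcd a b))" by (rule bdryE)
  obtain u v where uv: "u * a + v * b = gcd a b" using bezout_int by blast
  show "\<exists>G\<in>bdry a. \<exists>H\<in>bdry b. F = (\<lambda>x. G x + H x)"
  proof (intro bexI)
    \<comment> \<open>The term \<open>h (x + u * a)\<close> is inserted twice and cancels; the
      translation by the gcd is made in two jumps, by \<open>u * a\<close> and then by
      \<open>v * b\<close>.\<close>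
    show "F = (\<lambda>x. (h x + h (x + u * a)) + (h (x + u * a) + h (x + v * b + u * a)))"
      by (simp add: h(2) uv[symmetric] add_ac)
    show "(\<lambda>x. h x + h (x + u * a)) \<in> bdry a"
      using h(1) by (intro bdry_shift_multiple) auto
    show "(\<lambda>x. h (x + u * a) + h (x + v * b + u * a)) \<in> bdry b"
      using h(1) bdry_shift_multiple[of "\<lambda>x. h (x + u * a)" b "v * b"] by auto
  qed
next
  assume "\<exists>G\<in>bdry a. \<exists>H\<in>bdry b. F = (\<lambda>x. G x + H x)"
  then show "F \<in> bdry (gcd a b)"
    using bdry_mono[of "gcd a b" a] bdry_mono[of "gcd a b" b] by (auto intro!: bdry_add)
qed

text \<open>A period contains at most one point of each coset, so nothing can cancel.\<close>

lemma bdry_one_period: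
  assumes F: "F \<in> bdry n" and n: "n > 0" and supp: "\<And>x. F x \<noteq> 0 \<Longrightarrow> q \<le> x \<and> x < q + n"
  shows "F = (\<lambda>_. 0)"
proof -
  obtain h where h: "fin_supp h" "F = (\<lambda>x. h x + h (x + n))" using F by (rule bdryE)
  \<comment> \<open>\<open>F\<close> vanishes outside the window, so \<open>h\<close> repeats with
    period \<open>n\<close> there. Points at or beyond \<open>q + n\<close> are moved to the right
    and all others to the left, never across the window, until they leave the finite support of
    \<open>h\<close>.\<close>
  have out: "h x = h (x + n)" if "x < q \<or> x \<ge> q + n" for x
    using supp[of x] that bit_add_eq_0_iff[of "h x" "h (x + n)"] unfolding h(2) by linarith
  have fin: "finite {x. h x \<noteq> 0}" using h(1) by (simp add: fin_supp_def)
  have up: "h x = h (x + int m * n)" if "x \<ge> q + n" for x m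
  proof (induction m)
    case (Suc m)
    have "0 \<le> int m * n" using n by simp
    with out[of "x + int m * n"] that Suc show ?case by (simp add: algebra_simps)
  qed simp
  have down: "h x = h (x - int m * n)" if "x < q + n" for x m
  proof (induction m)
    case (Suc m)
    have "0 \<le> int m * n" using n by simp
    with out[of "x - int (Suc m) * n"] that Suc show ?case by (simp add: algebra_simps)
  qed simp
  have escape: "\<exists>m. h (x + int m * s) = 0" if "s \<noteq> 0" for x s
  proof (rule ccontr)
    assume "\<not> ?thesis"
    then have "range (\<lambda>m. x + int m * s) \<subseteq> {x. h x \<noteq> 0}" by auto
    then have "finite (range (\<lambda>m. x + int m * s))" using fin by (rule finite_subset)
    moreover have "inj (\<lambda>m. x + int m * s)" using that by (auto simp: inj_on_def)
    ultimately show False using finite_imageD infinite_UNIV_nat by blast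
  qed
  have "h x = 0" for x
  proof (cases "x \<ge> q + n")
    case True
    obtain m where "h (x + int m * n) = 0" using escape[of n x] n by auto
    with up[OF True, of m] show ?thesis by simp
  next
    case False
    obtain m where "h (x - int m * n) = 0" using escape[of "- n" x] n by auto
    with down[of x m] False show ?thesis by simp
  qed
  then show ?thesis by (simp add: h(2))
qed

section \<open>Values of words\<close>

lemma L2_mult: "(d1, f1) \<otimes>\<^bsub>L2\<^esub> (d2, f2) = (d1 + d2, \<lambda>x. f1 (x + d2) + f2 x)"
  by (simp add: L2_def shift_def)

lemma L2_one: "\<one>\<^bsub>L2\<^esub> = (0, \<lambda>_. 0)"
  by (simp add: L2_def)

lemma L2_carrier: "(d, f) \<in> carrier L2 \<longleftrightarrow> fin_supp f"
  by (simp add: L2_def fin_supp_def)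

lemma L2_inv:
  assumes "fin_supp f"
  shows "inv\<^bsub>L2\<^esub> (d, f) = (- d, \<lambda>x. f (x - d))"
  by (rule group.inv_equality[OF group_L2])
    (use assms in \<open>auto simp: L2_mult L2_one L2_carrier\<close>)

interpretation L2: group L2 by (rule group_L2)

definition vars :: "sym letter list \<Rightarrow> var set" where
  "vars W = {v. Pos (Var v) \<in> set W \<or> Inv (Var v) \<in> set W}"

lemma vars_append [simp]: "vars (U @ V) = vars U \<union> vars V"
  by (auto simp: vars_def)

definition vals :: "sym letter list \<Rightarrow> (int \<times> (int \<Rightarrow> bit)) set" where
  "vals W = {word_value \<sigma> W |\<sigma>. \<forall>v. \<sigma> v \<in> carrier L2}"

lemma solvable_iff_vals: "solvable W \<longleftrightarrow> \<one>\<^bsub>L2\<^esub> \<in> vals W"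
  by (auto simp: solvable_def vals_def) metis

lemma gen_elem_carrier: "gen_elem s \<in> carrier L2"
  by (cases s) (auto simp: L2_carrier fin_supp_def)

lemma letter_value_carrier: "\<forall>v. \<sigma> v \<in> carrier L2 \<Longrightarrow> letter_value \<sigma> l \<in> carrier L2"
proof (cases l)
  fix s assume "\<forall>v. \<sigma> v \<in> carrier L2"
  then have "sym_value \<sigma> s \<in> carrier L2" by (cases s) (auto simp: gen_elem_carrier)
  then show "l = Pos s \<Longrightarrow> letter_value \<sigma> l \<in> carrier L2" "l = Inv s \<Longrightarrow> letter_value \<sigma> l \<in> carrier L2"
    by auto
qed

lemma word_value_carrier: "\<forall>v. \<sigma> v \<in> carrier L2 \<Longrightarrow> word_value \<sigma> W \<in> carrier L2"
  by (induction W) (auto simp: letter_value_carrier)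

lemma word_value_append:
  "\<forall>v. \<sigma> v \<in> carrier L2 \<Longrightarrow> word_value \<sigma> (U @ V) = word_value \<sigma> U \<otimes>\<^bsub>L2\<^esub> word_value \<sigma> V"
  by (induction U) (auto simp: letter_value_carrier word_value_carrier L2.m_assoc)

lemma letter_value_cong:
  "\<forall>v\<in>vars [l]. \<sigma> v = \<tau> v \<Longrightarrow> letter_value \<sigma> l = letter_value \<tau> l"
  by (cases "(\<sigma>, l)" rule: letter_value.cases; rename_tac s; case_tac s) (auto simp: vars_def)

lemma word_value_cong:
  "\<forall>v\<in>vars W. \<sigma> v = \<tau> v \<Longrightarrow> word_value \<sigma> W = word_value \<tau> W"
proof (induction W)
  case (Cons l W)
  have "vars (l # W) = vars [l] \<union> vars W" by (auto simp: vars_def)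
  with Cons letter_value_cong[of l \<sigma> \<tau>] show ?case by simp
qed simp

text \<open>Two assignments are glued along \<open>vars U\<close>. With this the equation splits
  into factors whose value sets are computed one at a time.\<close>

lemma vals_append:
  assumes "vars U \<inter> vars V = {}"
  shows "vals (U @ V) = {u \<otimes>\<^bsub>L2\<^esub> v |u v. u \<in> vals U \<and> v \<in> vals V}"
proof (rule Set.set_eqI, rule iffI)
  fix w assume "w \<in> vals (U @ V)"
  then obtain \<sigma> where "\<forall>v. \<sigma> v \<in> carrier L2" "w = word_value \<sigma> U \<otimes>\<^bsub>L2\<^esub> word_value \<sigma> V"
    by (auto simp: vals_def word_value_append)
  then show "w \<in> {u \<otimes>\<^bsub>L2\<^esub> v |u v. u \<in> vals U \<and> v \<in> vals V}"
    unfolding vals_def by blast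
next
  fix w assume "w \<in> {u \<otimes>\<^bsub>L2\<^esub> v |u v. u \<in> vals U \<and> v \<in> vals V}"
  then obtain \<sigma> \<tau> where st: "\<forall>v. \<sigma> v \<in> carrier L2" "\<forall>v. \<tau> v \<in> carrier L2"
    and w: "w = word_value \<sigma> U \<otimes>\<^bsub>L2\<^esub> word_value \<tau> V"
    by (auto simp: vals_def)
  define \<rho> where "\<rho> = (\<lambda>v. if v \<in> vars U then \<sigma> v else \<tau> v)"
  have "\<forall>v. \<rho> v \<in> carrier L2" using st by (auto simp: \<rho>_def)
  moreover have "word_value \<sigma> U = word_value \<rho> U"
    by (rule word_value_cong) (auto simp: \<rho>_def)
  moreover have "word_value \<tau> V = word_value \<rho> V"
    by (rule word_value_cong) (use assms in \<open>auto simp: \<rho>_def\<close>)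
  ultimately have "w = word_value \<rho> (U @ V)" "\<forall>v. \<rho> v \<in> carrier L2"
    unfolding w by (simp_all add: word_value_append)
  then show "w \<in> vals (U @ V)" unfolding vals_def by blast
qed

section \<open>Constants and their conjugates\<close>

fun delta :: "gen letter list \<Rightarrow> int" where
  "delta [] = 0"
| "delta (Pos GenA # c) = delta c"
| "delta (Inv GenA # c) = delta c"
| "delta (Pos GenT # c) = delta c + 1"
| "delta (Inv GenT # c) = delta c - 1"

text \<open>The lamps toggled by a walker who starts at \<open>p\<close> and reads \<open>c\<close>,
  in absolute positions.\<close>

fun flips :: "int \<Rightarrow> gen letter list \<Rightarrow> int \<Rightarrow> bit" where
  "flips p [] = (\<lambda>x. 0)"
| "flips p (Pos GenA # c) = (\<lambda>x. (if x = p then 1 else 0) + flips p c x)"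
| "flips p (Inv GenA # c) = (\<lambda>x. (if x = p then 1 else 0) + flips p c x)"
| "flips p (Pos GenT # c) = flips (p + 1) c"
| "flips p (Inv GenT # c) = flips (p - 1) c"

lemma fin_supp_flips [simp]: "fin_supp (flips p c)"
proof (induction p c rule: flips.induct)
  case (2 p c)
  have "fin_supp (\<lambda>x. if x = p then 1 else 0)" by (simp add: fin_supp_def)
  from fin_supp_add[OF this 2] show ?case by simp
next
  case (3 p c)
  have "fin_supp (\<lambda>x. if x = p then 1 else 0)" by (simp add: fin_supp_def)
  from fin_supp_add[OF this 3] show ?case by simp
qed auto

lemma flips_shift: "flips (p + b) c x = flips p c (x - b)"
proof (induction p c arbitrary: x rule: flips.induct)
  case (4 p c)
  then show ?case by (metis add.assoc add.commute flips.simps(4))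
next
  case (5 p c)
  have "p + b - 1 = p - 1 + b" by simp
  with 5 show ?case by (metis flips.simps(5))
qed auto

text \<open>A product shifts its left factor by the displacement of the right one, so the lamp part
  of a group element is seen from the end of the walk; hence the argument
  \<open>x + delta c\<close>.\<close>

lemma word_value_const:
  "word_value \<sigma> (map (map_letter Gen) c) = (delta c, \<lambda>x. flips 0 c (x + delta c))"
proof (induction c rule: delta.induct)
  case (2 c)
  have "flips 0 (Pos GenA # c) = (\<lambda>x. (if x = 0 then 1 else 0) + flips 0 c x)" by simp
  with 2 show ?case by (simp add: L2_mult)
next
  case (3 c)
  have "inv\<^bsub>L2\<^esub> (0, \<lambda>x. if x = 0 then 1 else 0) = (0, \<lambda>x. if x = (0::int) then 1 else (0::bit))"
    by (subst L2_inv) (auto simp: fin_supp_def)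
  with 3 show ?case by (simp add: L2_mult)
next
  case (4 c)
  then show ?case using flips_shift[of 0 1 c] by (simp add: L2_mult add_ac)
next
  case (5 c)
  then show ?case using flips_shift[of 0 "- 1" c] by (simp add: L2_mult L2_inv fun_eq_iff add_ac)
qed (simp add: L2_one)

text \<open>Conjugation by \<open>(e, h)\<close> translates the lamps and adds a boundary of
  \<open>h\<close>. All offsets disappear in the existential \<open>e\<close>, which runs through
  every translate anyway.\<close>

lemma vals_conj_word:
  "vals (conj_word j c) = {(delta c, G) |G. \<exists>e. (\<lambda>x. G x + flips e c x) \<in> bdry (delta c)}"
proof -
  have *: "word_value \<sigma> (conj_word j c)
      = (delta c, \<lambda>x. (h x + h (x + delta c)) + flips 0 c (x + delta c + e))"
    if \<sigma>: "\<forall>v. \<sigma> v \<in> carrier L2" and z: "\<sigma> (VarZ j) = (e, h)" for \<sigma> e h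
  proof -
    have h: "fin_supp h" using \<sigma> z by (metis L2_carrier)
    have "word_value \<sigma> (conj_word j c) = inv\<^bsub>L2\<^esub> (e, h) \<otimes>\<^bsub>L2\<^esub> ((delta c, \<lambda>x. flips 0 c (x + delta c)) \<otimes>\<^bsub>L2\<^esub> (e, h))"
      unfolding conj_word_def using word_value_append[OF \<sigma>]
      by (simp add: word_value_const z L2_one L2_mult)
    also have "\<dots> = (delta c, \<lambda>x. (h x + h (x + delta c)) + flips 0 c (x + delta c + e))"
      by (simp add: L2_inv[OF h] L2_mult fun_eq_iff algebra_simps)
    finally show ?thesis .
  qed
  show ?thesis
  proof (rule Set.set_eqI, rule iffI)
    fix w assume "w \<in> vals (conj_word j c)"
    then obtain \<sigma> where \<sigma>: "\<forall>v. \<sigma> v \<in> carrier L2" and w: "w = word_value \<sigma> (conj_word j c)"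
      by (auto simp: vals_def)
    obtain e h where z: "\<sigma> (VarZ j) = (e, h)" by (cases "\<sigma> (VarZ j)")
    have h: "fin_supp h" using \<sigma> z by (metis L2_carrier)
    show "w \<in> {(delta c, G) |G. \<exists>e. (\<lambda>x. G x + flips e c x) \<in> bdry (delta c)}"
      unfolding w *[OF \<sigma> z]
      \<comment> \<open>Evaluating \<open>flips 0 c\<close> at \<open>x + delta c + e\<close>
        amounts to starting the walk at \<open>- (delta c + e)\<close>.\<close>
      by (auto intro!: exI[of _ "- (delta c + e)"] bdryI[OF h]
          simp: flips_shift[of 0 "- e - delta c" c, simplified] algebra_simps)
  next
    fix w assume "w \<in> {(delta c, G) |G. \<exists>e. (\<lambda>x. G x + flips e c x) \<in> bdry (delta c)}"
    then obtain G e where w: "w = (delta c, G)" and "(\<lambda>x. G x + flips e c x) \<in> bdry (delta c)" by auto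
    then obtain h where h: "fin_supp h" "(\<lambda>x. G x + flips e c x) = (\<lambda>x. h x + h (x + delta c))"
      by (elim bdryE)
    \<comment> \<open>The inverse substitution: a conjugator with displacement
      \<open>- e - delta c\<close> makes the walk start at \<open>e\<close>.\<close>
    define \<sigma> where "\<sigma> = (\<lambda>v. if v = VarZ j then (- e - delta c, h) else \<one>\<^bsub>L2\<^esub>)"
    have "\<forall>v. \<sigma> v \<in> carrier L2" using h by (simp add: \<sigma>_def L2_carrier)
    moreover have "word_value \<sigma> (conj_word j c) = w"
    proof (subst *[of \<sigma> "- e - delta c" h])
      have "G x + flips e c x + flips e c x = h x + h (x + delta c) + flips e c x" for x
        using fun_cong[OF h(2), of x] by simp
      then have "G x = h x + h (x + delta c) + flips e c x" for x
        by (simp add: add.assoc)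
      then show "(delta c, \<lambda>x. h x + h (x + delta c) + flips 0 c (x + delta c + (- e - delta c))) = w"
        by (simp add: w flips_shift[of 0 e c, simplified] fun_eq_iff)
    qed (use h in \<open>auto simp: \<sigma>_def L2_carrier\<close>)
    ultimately show "w \<in> vals (conj_word j c)" by (auto simp: vals_def)
  qed
qed

section \<open>Products of conjugates\<close>

definition conj_prod_from :: "nat \<Rightarrow> gen letter list list \<Rightarrow> sym letter list" where
  "conj_prod_from j cs = concat (map2 conj_word [j..<j + length cs] cs)"

lemma conj_prod_from_simps [simp]:
  "conj_prod_from j [] = []"
  "conj_prod_from j (c # cs) = conj_word j c @ conj_prod_from (Suc j) cs"
  by (auto simp: conj_prod_from_def upt_rec[of j] simp del: upt.simps)

lemma conj_prod_eq: "conj_prod cs = conj_prod_from 1 cs"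
  by (simp add: conj_prod_def conj_prod_from_def)

fun gcds :: "gen letter list list \<Rightarrow> int" where
  "gcds [] = 0"
| "gcds (c # cs) = gcd (delta c) (gcds cs)"

fun flips_sum :: "int list \<Rightarrow> gen letter list list \<Rightarrow> int \<Rightarrow> bit" where
  "flips_sum (e # es) (c # cs) = (\<lambda>x. flips e c x + flips_sum es cs x)"
| "flips_sum _ _ = (\<lambda>x. 0)"

lemma fin_supp_flips_sum [simp]: "fin_supp (flips_sum es cs)"
  by (induction es cs rule: flips_sum.induct) auto

lemma flips_sum_shift: "flips_sum (map (\<lambda>e. e + b) es) cs x = flips_sum es cs (x - b)"
  by (induction es cs rule: flips_sum.induct) (auto simp: flips_shift)

lemma vars_conj_word: "vars (conj_word j c) = {VarZ j}"
proof -
  have "map_letter Gen l \<noteq> Pos (Var v)" "map_letter Gen l \<noteq> Inv (Var v)" for l v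
    by (cases l; simp)+
  note this[THEN not_sym]
  then show ?thesis by (auto simp: vars_def conj_word_def)
qed

lemma vars_conj_prod_from: "vars (conj_prod_from j cs) \<subseteq> VarZ ` {j..}"
proof (induction cs arbitrary: j)
  case (Cons c cs)
  have "VarZ ` {Suc j..} \<subseteq> VarZ ` {j..}" by auto
  with Cons[of "Suc j"] show ?case by (auto simp: vars_conj_word)
qed (simp add: vars_def)

text \<open>\<open>F\<close> agrees modulo \<open>bdry n\<close> with a sum of translates of the
  lamp parts of the constants. For \<open>F = 0\<close> this is the question that remains once the
  displacements fit.\<close>

definition attains :: "int \<Rightarrow> gen letter list list \<Rightarrow> (int \<Rightarrow> bit) \<Rightarrow> bool" where
  "attains n cs F \<longleftrightarrow> (\<exists>es. length es = length cs \<and> (\<lambda>x. F x + flips_sum es cs x) \<in> bdry n)"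

text \<open>Each factor brings its own group of boundaries, and these add up to that of the gcd. The
  displacement of the later factors translates the earlier ones, which the free starting positions
  absorb.\<close>

lemma vals_conj_prod_from:
  "vals (conj_prod_from j cs) = {(sum_list (map delta cs), F) |F. attains (gcds cs) cs F}"
proof (induction cs arbitrary: j)
  case Nil
  show ?case by (auto simp: vals_def L2_one attains_def intro!: exI[of _ "\<lambda>_. \<one>\<^bsub>L2\<^esub>"])
next
  case (Cons c cs)
  let ?s = "sum_list (map delta cs)"
  have disj: "vars (conj_word j c) \<inter> vars (conj_prod_from (Suc j) cs) = {}"
    using vars_conj_prod_from[of "Suc j" cs] by (auto simp: vars_conj_word)
  show ?case
    unfolding conj_prod_from_simps vals_append[OF disj] Cons vals_conj_word
  proof (rule Set.set_eqI, rule iffI)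
    fix w assume "w \<in> {u \<otimes>\<^bsub>L2\<^esub> v |u v. u \<in> {(delta c, G) |G. \<exists>e. (\<lambda>x. G x + flips e c x) \<in> bdry (delta c)}
        \<and> v \<in> {(?s, F) |F. attains (gcds cs) cs F}}"
    then obtain G e H es where w: "w = (delta c + ?s, \<lambda>x. G (x + ?s) + H x)"
      and G: "(\<lambda>x. G x + flips e c x) \<in> bdry (delta c)" and len: "length es = length cs"
      and H: "(\<lambda>x. H x + flips_sum es cs x) \<in> bdry (gcds cs)"
      by (auto simp: L2_mult attains_def)
    have "(\<lambda>x. G (x + ?s) + flips (e - ?s) c x) \<in> bdry (delta c)"
      using bdry_shift[OF G, of ?s] flips_shift[of e "- ?s" c] by simp
    then have "(\<lambda>x. (G (x + ?s) + flips (e - ?s) c x) + (H x + flips_sum es cs x)) \<in> bdry (gcds (c # cs))"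
      using H unfolding gcds.simps bdry_gcd by (rule_tac bexI, rule_tac bexI, rule_tac refl)
    then have "(\<lambda>x. (G (x + ?s) + H x) + flips_sum ((e - ?s) # es) (c # cs) x) \<in> bdry (gcds (c # cs))"
      by (simp add: add_ac)
    then show "w \<in> {(sum_list (map delta (c # cs)), F) |F. attains (gcds (c # cs)) (c # cs) F}"
      unfolding w attains_def list.map sum_list.Cons mem_Collect_eq using len
      by (intro exI[of _ "\<lambda>x. G (x + ?s) + H x"] conjI refl exI[of _ "(e - ?s) # es"]) simp_all
  next
    fix w assume "w \<in> {(sum_list (map delta (c # cs)), F) |F. attains (gcds (c # cs)) (c # cs) F}"
    then obtain F e es where w: "w = (delta c + ?s, F)" and len: "length es = length cs"
      and F: "(\<lambda>x. F x + flips_sum (e # es) (c # cs) x) \<in> bdry (gcd (delta c) (gcds cs))"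
      by (auto simp: attains_def length_Suc_conv)
    obtain G H where G: "G \<in> bdry (delta c)" and H: "H \<in> bdry (gcds cs)"
      and eq: "(\<lambda>x. F x + flips_sum (e # es) (c # cs) x) = (\<lambda>x. G x + H x)"
      using F unfolding bdry_gcd by blast
    have Feq: "F x = (G x + flips e c x) + (H x + flips_sum es cs x)" for x
    proof -
      have "F x + (flips e c x + flips_sum es cs x) = G x + H x"
        using fun_cong[OF eq, of x] by simp
      then have "F x + (flips e c x + flips_sum es cs x) + (flips e c x + flips_sum es cs x)
        = G x + H x + (flips e c x + flips_sum es cs x)" by simp
      then show ?thesis by (simp add: add.assoc add.left_commute)
    qed
    \<comment> \<open>The lamps of the first factor are moved by \<open>?s\<close> in advance, since
      multiplication by the second factor moves them back.\<close>
    let ?G = "\<lambda>x. G (x - ?s) + flips (e + ?s) c x" and ?H = "\<lambda>x. H x + flips_sum es cs x"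
    have "w = (delta c, ?G) \<otimes>\<^bsub>L2\<^esub> (?s, ?H)"
      by (simp add: w L2_mult fun_eq_iff Feq flips_shift)
    moreover have "\<exists>e'. (\<lambda>x. ?G x + flips e' c x) \<in> bdry (delta c)"
    proof
      show "(\<lambda>x. ?G x + flips (e + ?s) c x) \<in> bdry (delta c)"
      using bdry_shift[OF G, of "- ?s"] by (simp add: add.assoc)
    qed
    moreover have "(\<lambda>x. ?H x + flips_sum es cs x) \<in> bdry (gcds cs)"
      using H by (simp add: add.assoc)
    then have "attains (gcds cs) cs ?H" unfolding attains_def using len by blast
    ultimately show "w \<in> {u \<otimes>\<^bsub>L2\<^esub> v |u v. u \<in> {(delta c, G) |G. \<exists>e. (\<lambda>x. G x + flips e c x) \<in> bdry (delta c)}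
        \<and> v \<in> {(?s, F) |F. attains (gcds cs) cs F}}"
      by (intro CollectI exI[of _ "(delta c, ?G)"] exI[of _ "(?s, ?H)"] conjI exI[of _ ?G] exI[of _ ?H] refl)
  qed
qed

section \<open>Products of commutators and of squares\<close>

definition comm_prod_from :: "nat \<Rightarrow> nat \<Rightarrow> sym letter list" where
  "comm_prod_from i m = concat (map comm_word [i..<i + m])"

definition square_prod_from :: "nat \<Rightarrow> nat \<Rightarrow> sym letter list" where
  "square_prod_from i m = concat (map square_word [i..<i + m])"

lemma comm_prod_from_simps [simp]:
  "comm_prod_from i 0 = []"
  "comm_prod_from i (Suc m) = comm_word i @ comm_prod_from (Suc i) m"
  by (auto simp: comm_prod_from_def upt_rec[of i] simp del: upt.simps)

lemma square_prod_from_simps [simp]: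
  "square_prod_from i 0 = []"
  "square_prod_from i (Suc m) = square_word i @ square_prod_from (Suc i) m"
  by (auto simp: square_prod_from_def upt_rec[of i] simp del: upt.simps)

lemma comm_prod_eq: "comm_prod g = comm_prod_from 1 g"
  by (simp add: comm_prod_def comm_prod_from_def)

lemma square_prod_eq: "square_prod g = square_prod_from 1 g"
  by (simp add: square_prod_def square_prod_from_def)

lemma vars_comm_word: "vars (comm_word i) = {VarX i, VarY i}"
  by (auto simp: vars_def comm_word_def)

lemma vars_square_word: "vars (square_word i) = {VarX i}"
  by (auto simp: vars_def square_word_def)

lemma vars_comm_prod_from: "vars (comm_prod_from i m) \<subseteq> VarX ` {i..} \<union> VarY ` {i..}"
proof (induction m arbitrary: i)
  case (Suc m)
  have "{Suc i..} \<subseteq> {i..}" by auto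
  with Suc[of "Suc i"] show ?case by (fastforce simp: vars_comm_word)
qed (simp add: vars_def)

lemma vars_square_prod_from: "vars (square_prod_from i m) \<subseteq> VarX ` {i..}"
proof (induction m arbitrary: i)
  case (Suc m)
  have "{Suc i..} \<subseteq> {i..}" by auto
  with Suc[of "Suc i"] show ?case by (fastforce simp: vars_square_word)
qed (simp add: vars_def)

lemma vals_comm_word: "vals (comm_word i) = {(0, F) |F. F \<in> bdry 1}"
proof -
  have *: "word_value \<sigma> (comm_word i) = (0, \<lambda>x. (f x + f (x + e)) + (h x + h (x + d)))"
    if \<sigma>: "\<forall>v. \<sigma> v \<in> carrier L2" and xy: "\<sigma> (VarX i) = (d, f)" "\<sigma> (VarY i) = (e, h)" for \<sigma> d f e h
  proof -
    have "fin_supp f" "fin_supp h" using \<sigma> xy by (metis L2_carrier)+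
    then show ?thesis
      by (simp add: comm_word_def xy L2_inv L2_mult L2_one fun_eq_iff algebra_simps)
  qed
  show ?thesis
  proof (rule Set.set_eqI, rule iffI)
    fix w assume "w \<in> vals (comm_word i)"
    then obtain \<sigma> where \<sigma>: "\<forall>v. \<sigma> v \<in> carrier L2" and w: "w = word_value \<sigma> (comm_word i)"
      by (auto simp: vals_def)
    obtain d f e h where xy: "\<sigma> (VarX i) = (d, f)" "\<sigma> (VarY i) = (e, h)" by (meson surj_pair)
    have "fin_supp f" "fin_supp h" using \<sigma> xy by (metis L2_carrier)+
    then have "(\<lambda>x. (f x + f (x + e)) + (h x + h (x + d))) \<in> bdry 1"
      by (intro bdry_add bdry_shift_multiple) auto
    then show "w \<in> {(0, F) |F. F \<in> bdry 1}" unfolding w *[OF \<sigma> xy] by blast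
  next
    fix w :: "int \<times> (int \<Rightarrow> bit)" assume "w \<in> {(0, F) |F. F \<in> bdry 1}"
    then obtain f where f: "fin_supp f" and w: "w = (0, \<lambda>x. f x + f (x + 1))" by (auto elim: bdryE)
    \<comment> \<open>With \<open>y = t\<close> and \<open>x\<close> without displacement the
      commutator has lamp part \<open>f x + f (x + 1)\<close>, so a single commutator already fills
      \<open>bdry 1\<close>.\<close>
    define \<sigma> where "\<sigma> = (\<lambda>v. if v = VarX i then (0, f) else (1::int, \<lambda>_. 0::bit))"
    have \<sigma>: "\<forall>v. \<sigma> v \<in> carrier L2" using f by (simp add: \<sigma>_def L2_carrier)
    moreover have "word_value \<sigma> (comm_word i) = w"
      using *[OF \<sigma>, of 0 f 1 "\<lambda>_. 0"] by (simp add: \<sigma>_def w)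
    ultimately show "w \<in> vals (comm_word i)" unfolding vals_def by blast
  qed
qed

lemma vals_square_word: "vals (square_word i) = {(2 * d, F) |d F. F \<in> bdry d}"
proof -
  have *: "word_value \<sigma> (square_word i) = (2 * d, \<lambda>x. f x + f (x + d))"
    if "\<sigma> (VarX i) = (d, f)" for \<sigma> d f
    using that by (simp add: square_word_def L2_mult L2_one add_ac)
  show ?thesis
  proof (rule Set.set_eqI, rule iffI)
    fix w assume "w \<in> vals (square_word i)"
    then obtain \<sigma> where \<sigma>: "\<forall>v. \<sigma> v \<in> carrier L2" and w: "w = word_value \<sigma> (square_word i)"
      by (auto simp: vals_def)
    obtain d f where x: "\<sigma> (VarX i) = (d, f)" by (meson surj_pair)
    have "fin_supp f" using \<sigma> x by (metis L2_carrier)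
    then have "(\<lambda>x. f x + f (x + d)) \<in> bdry d" by (intro bdry_shift_multiple) auto
    then show "w \<in> {(2 * d, F) |d F. F \<in> bdry d}" unfolding w *[of \<sigma> d f, OF x] by blast
  next
    fix w :: "int \<times> (int \<Rightarrow> bit)" assume "w \<in> {(2 * d, F) |d F. F \<in> bdry d}"
    then obtain d f where f: "fin_supp f" and w: "w = (2 * d, \<lambda>x. f x + f (x + d))" by (auto elim: bdryE)
    have "\<forall>v. (\<lambda>_::var. (d, f)) v \<in> carrier L2" using f by (simp add: L2_carrier)
    moreover have "w = word_value (\<lambda>_. (d, f)) (square_word i)" unfolding w by (rule *[symmetric]) simp
    ultimately show "w \<in> vals (square_word i)" unfolding vals_def by blast
  qed
qed

text \<open>Commutators have displacement 0, so their lamp parts add without any shift, and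
  \<open>bdry 1\<close> is closed under addition: further commutators gain nothing.\<close>

lemma vals_comm_prod_from: "vals (comm_prod_from i (Suc m)) = {(0, F) |F. F \<in> bdry 1}"
proof (induction m arbitrary: i)
  case 0
  show ?case using vals_comm_word by simp
next
  case (Suc m)
  have disj: "vars (comm_word i) \<inter> vars (comm_prod_from (Suc i) (Suc m)) = {}"
    using vars_comm_prod_from[of "Suc i" "Suc m"] by (auto simp: vars_comm_word)
  show ?case
    unfolding comm_prod_from_simps(2)[of i "Suc m"] vals_append[OF disj] vals_comm_word Suc
  proof (rule Set.set_eqI, rule iffI)
    fix w :: "int \<times> (int \<Rightarrow> bit)"
    assume "w \<in> {u \<otimes>\<^bsub>L2\<^esub> v |u v. u \<in> {(0, F) |F. F \<in> bdry 1} \<and> v \<in> {(0, F) |F. F \<in> bdry 1}}"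
    then show "w \<in> {(0, F) |F. F \<in> bdry 1}"
      by (auto simp: L2_mult intro: bdry_add)
  next
    fix w :: "int \<times> (int \<Rightarrow> bit)" assume "w \<in> {(0, F) |F. F \<in> bdry 1}"
    then obtain F where F: "w = (0, F)" "F \<in> bdry 1" by auto
    show "w \<in> {u \<otimes>\<^bsub>L2\<^esub> v |u v. u \<in> {(0, F) |F. F \<in> bdry 1} \<and> v \<in> {(0, F) |F. F \<in> bdry 1}}"
      by (intro CollectI exI[of _ "(0, F)"] exI[of _ "(0, \<lambda>_. 0)"] conjI exI[of _ F] exI[of _ "\<lambda>_. 0"] refl F bdry_zero)
        (simp add: L2_mult F)
  qed
qed

text \<open>Variables of displacement 1 and \<open>d - 1\<close> give squares of total displacement
  \<open>2 * d\<close>, and the first of them contributes all of \<open>bdry 1\<close>. Further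
  squares gain nothing.\<close>

lemma vals_square_prod_from:
  "vals (square_prod_from i (Suc (Suc m))) = {(2 * d, F) |d F. F \<in> bdry 1}"
proof (induction m arbitrary: i)
  case 0
  have disj: "vars (square_word i) \<inter> vars (square_word (Suc i)) = {}"
    by (auto simp: vars_square_word)
  have eq: "square_prod_from i (Suc (Suc 0)) = square_word i @ square_word (Suc i)" by simp
  show ?case
    unfolding eq vals_append[OF disj] vals_square_word
  proof (rule Set.set_eqI, rule iffI)
    fix w :: "int \<times> (int \<Rightarrow> bit)"
    assume "w \<in> {u \<otimes>\<^bsub>L2\<^esub> v |u v. u \<in> {(2 * d, F) |d F. F \<in> bdry d} \<and> v \<in> {(2 * d, F) |d F. F \<in> bdry d}}"
    then obtain d F e H where F: "F \<in> bdry d" "H \<in> bdry e" and w: "w = (2 * d + 2 * e, \<lambda>x. F (x + 2 * e) + H x)"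
      by (auto simp: L2_mult)
    have "F \<in> bdry 1" "H \<in> bdry 1" using F bdry_mono[of 1 d] bdry_mono[of 1 e] by auto
    then have "(\<lambda>x. F (x + 2 * e) + H x) \<in> bdry 1" by (intro bdry_add bdry_shift)
    then show "w \<in> {(2 * d, F) |d F. F \<in> bdry 1}"
      unfolding w by (intro CollectI exI[of _ "d + e"] exI[of _ "\<lambda>x. F (x + 2 * e) + H x"]) simp
  next
    fix w :: "int \<times> (int \<Rightarrow> bit)" assume "w \<in> {(2 * d, F) |d F. F \<in> bdry 1}"
    then obtain d F where F: "w = (2 * d, F)" "F \<in> bdry 1" by auto
    \<comment> \<open>The translation compensates the displacement \<open>2 * (d - 1)\<close> of the
      second square.\<close>
    let ?F = "\<lambda>x. F (x - 2 * (d - 1))"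
    have "?F \<in> bdry 1" using bdry_shift[OF F(2), of "- (2 * (d - 1))"] by (simp only: diff_conv_add_uminus)
    then show "w \<in> {u \<otimes>\<^bsub>L2\<^esub> v |u v. u \<in> {(2 * d, F) |d F. F \<in> bdry d} \<and> v \<in> {(2 * d, F) |d F. F \<in> bdry d}}"
      by (intro CollectI exI[of _ "(2, ?F)"] exI[of _ "(2 * (d - 1), \<lambda>_. 0)"] conjI exI[of _ 1] exI[of _ ?F]
          exI[of _ "d - 1"] exI[of _ "\<lambda>_. 0"] bdry_zero refl)
        (simp_all add: L2_mult F algebra_simps)
  qed
next
  case (Suc m)
  have disj: "vars (square_word i) \<inter> vars (square_prod_from (Suc i) (Suc (Suc m))) = {}"
    using vars_square_prod_from[of "Suc i" "Suc (Suc m)"] by (auto simp: vars_square_word)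
  show ?case
    unfolding square_prod_from_simps(2)[of i "Suc (Suc m)"] vals_append[OF disj] vals_square_word Suc
  proof (rule Set.set_eqI, rule iffI)
    fix w :: "int \<times> (int \<Rightarrow> bit)"
    assume "w \<in> {u \<otimes>\<^bsub>L2\<^esub> v |u v. u \<in> {(2 * d, F) |d F. F \<in> bdry d} \<and> v \<in> {(2 * d, F) |d F. F \<in> bdry 1}}"
    then obtain d F e H where F: "F \<in> bdry d" "H \<in> bdry 1" and w: "w = (2 * d + 2 * e, \<lambda>x. F (x + 2 * e) + H x)"
      by (auto simp: L2_mult)
    have "F \<in> bdry 1" using F bdry_mono[of 1 d] by auto
    then have "(\<lambda>x. F (x + 2 * e) + H x) \<in> bdry 1" by (intro bdry_add bdry_shift F)
    then show "w \<in> {(2 * d, F) |d F. F \<in> bdry 1}"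
      unfolding w by (intro CollectI exI[of _ "d + e"] exI[of _ "\<lambda>x. F (x + 2 * e) + H x"]) simp
  next
    fix w :: "int \<times> (int \<Rightarrow> bit)" assume "w \<in> {(2 * d, F) |d F. F \<in> bdry 1}"
    then obtain d F where F: "w = (2 * d, F)" "F \<in> bdry 1" by auto
    show "w \<in> {u \<otimes>\<^bsub>L2\<^esub> v |u v. u \<in> {(2 * d, F) |d F. F \<in> bdry d} \<and> v \<in> {(2 * d, F) |d F. F \<in> bdry 1}}"
      by (intro CollectI exI[of _ "(0, \<lambda>_. 0)"] exI[of _ "(2 * d, F)"] conjI exI[of _ 0] exI[of _ "\<lambda>_. 0"]
          exI[of _ d] exI[of _ F] bdry_zero refl F)
        (simp_all add: L2_mult F)
  qed
qed

text \<open>One format for all prefixes: \<open>n0 = 1\<close> gives \<open>bdry 1\<close>,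
  \<open>n0 = 0\<close> gives \<open>bdry d\<close>, and \<open>S\<close> will be \<open>{0}\<close>
  unless the prefix consists of squares. Displacements must cancel, and the boundaries of the prefix
  and of the conjugates combine to those of the gcd.\<close>

lemma solvable_append_conj_prod:
  assumes vars: "vars pre \<inter> range VarZ = {}"
    and pre: "vals pre = {(2 * d, F) |d F. d \<in> S \<and> F \<in> bdry (gcd n0 d)}"
  shows "solvable (pre @ conj_prod cs) \<longleftrightarrow>
    (\<exists>d\<in>S. 2 * d + sum_list (map delta cs) = 0 \<and> attains (gcd (gcd n0 d) (gcds cs)) cs (\<lambda>_. 0))"
    (is "_ \<longleftrightarrow> (\<exists>d\<in>S. _ d + ?s = 0 \<and> _ d)")
proof -
  have disj: "vars pre \<inter> vars (conj_prod_from 1 cs) = {}"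
    using vars vars_conj_prod_from[of 1 cs] by blast
  show ?thesis
    unfolding solvable_iff_vals conj_prod_eq vals_append[OF disj] pre vals_conj_prod_from
  proof
    assume "\<one>\<^bsub>L2\<^esub> \<in> {u \<otimes>\<^bsub>L2\<^esub> v |u v. u \<in> {(2 * d, F) |d F. d \<in> S \<and> F \<in> bdry (gcd n0 d)}
      \<and> v \<in> {(?s, F) |F. attains (gcds cs) cs F}}"
    then obtain d F H where d: "d \<in> S" "2 * d + ?s = 0" and F: "F \<in> bdry (gcd n0 d)"
      and eq: "(\<lambda>x. F (x + ?s) + H x) = (\<lambda>_. 0)" and H: "attains (gcds cs) cs H"
      by (clarsimp simp: L2_mult L2_one)
    have Heq: "F (x + ?s) = H x" for x using fun_cong[OF eq, of x] by (simp add: bit_add_eq_0_iff)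
    obtain es where es: "length es = length cs" "(\<lambda>x. H x + flips_sum es cs x) \<in> bdry (gcds cs)"
      using H by (auto simp: attains_def)
    have "H \<in> bdry (gcd n0 d)" using bdry_shift[OF F, of ?s] Heq by simp
    moreover have "flips_sum es cs = (\<lambda>x. H x + (H x + flips_sum es cs x))" by simp
    ultimately have "flips_sum es cs \<in> bdry (gcd (gcd n0 d) (gcds cs))"
      using es(2) unfolding bdry_gcd[of _ "gcd n0 d"] by (rule_tac bexI, rule_tac bexI)
    then show "\<exists>d\<in>S. 2 * d + ?s = 0 \<and> attains (gcd (gcd n0 d) (gcds cs)) cs (\<lambda>_. 0)"
      using d es(1) by (intro bexI[of _ d]) (auto simp: attains_def)
  next
    assume "\<exists>d\<in>S. 2 * d + ?s = 0 \<and> attains (gcd (gcd n0 d) (gcds cs)) cs (\<lambda>_. 0)"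
    then obtain d es where d: "d \<in> S" "2 * d + ?s = 0" and es: "length es = length cs"
      "flips_sum es cs \<in> bdry (gcd (gcd n0 d) (gcds cs))"
      by (auto simp: attains_def)
    obtain G H where G: "G \<in> bdry (gcd n0 d)" and H: "H \<in> bdry (gcds cs)"
      and eq: "flips_sum es cs = (\<lambda>x. G x + H x)"
      using es(2) unfolding bdry_gcd[of _ "gcd n0 d"] by auto
    have "attains (gcds cs) cs G"
      unfolding attains_def using es(1) H by (intro exI[of _ es]) (simp add: eq)
    moreover have "(\<lambda>x. G (x - ?s)) \<in> bdry (gcd n0 d)"
      using bdry_shift[OF G, of "- ?s"] by simp
    moreover have "\<one>\<^bsub>L2\<^esub> = (2 * d, \<lambda>x. G (x - ?s)) \<otimes>\<^bsub>L2\<^esub> (?s, G)"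
      by (simp add: L2_mult L2_one d)
    ultimately show "\<one>\<^bsub>L2\<^esub> \<in> {u \<otimes>\<^bsub>L2\<^esub> v |u v. u \<in> {(2 * d, F) |d F. d \<in> S \<and> F \<in> bdry (gcd n0 d)}
      \<and> v \<in> {(?s, F) |F. attains (gcds cs) cs F}}"
      using d(1)
      by (intro CollectI exI[of _ "(2 * d, \<lambda>x. G (x - ?s))"] exI[of _ "(?s, G)"] conjI exI[of _ d]
          exI[of _ "\<lambda>x. G (x - ?s)"] exI[of _ G] refl)
  qed
qed

section \<open>Passing to a circle\<close>

text \<open>Every position of the walk is recorded, not only those of toggled lamps: the whole path
  has to avoid the cut.\<close>

fun visits :: "int \<Rightarrow> gen letter list \<Rightarrow> int set" where
  "visits p [] = {p}"
| "visits p (Pos GenA # c) = visits p c"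
| "visits p (Inv GenA # c) = visits p c"
| "visits p (Pos GenT # c) = insert p (visits (p + 1) c)"
| "visits p (Inv GenT # c) = insert p (visits (p - 1) c)"

lemma visits_self [simp]: "p \<in> visits p c"
  by (induction p c rule: visits.induct) auto

lemma finite_visits [simp]: "finite (visits p c)"
  by (induction p c rule: visits.induct) auto

lemma card_visits: "card (visits p c) \<le> length c + 1"
  by (induction p c rule: visits.induct) (auto intro: card_insert_le_m1 order_trans[OF card_insert_le_m1])

lemma visits_shift: "visits (p + b) c = (\<lambda>x. x + b) ` visits p c"
proof (induction p c rule: visits.induct)
  case (4 p c)
  have "p + b + 1 = p + 1 + b" by simp
  with 4 show ?case by (metis image_insert visits.simps(4))
next
  case (5 p c)
  have "p + b - 1 = p - 1 + b" by simp
  with 5 show ?case by (metis image_insert visits.simps(5))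
qed auto

text \<open>The walk moves by single steps, so it cannot jump over a coset of \<open>n\<int>\<close> that it avoids.\<close>

lemma flips_confined:
  assumes "\<And>y. y \<in> visits p c \<Longrightarrow> \<not> n dvd y - q" "q < p" "p < q + n" "flips p c x \<noteq> 0"
  shows "q < x \<and> x < q + n"
  using assms
proof (induction p c rule: flips.induct)
  case (4 p c)
  have "p + 1 \<noteq> q + n" using 4(2)[of "p + 1"] by auto
  with 4 show ?case by simp
next
  case (5 p c)
  have "p - 1 \<noteq> q" using 5(2)[of "p - 1"] by auto
  with 5 show ?case by simp
qed (auto split: if_splits)

text \<open>Pigeonhole: fewer than \<open>n\<close> positions are visited in total, so some residue
  modulo \<open>n\<close> stays free.\<close>

lemma avoid_residue:
  assumes "length es = length cs" "sum_list (map (\<lambda>c. length c + 1) cs) < n"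
  shows "\<exists>q. \<forall>(e, c)\<in>set (zip es cs). \<forall>y\<in>visits e c. \<not> int n dvd y - q"
proof -
  define A where "A = (\<Union>(e, c)\<in>set (zip es cs). visits e c)"
  have "card A \<le> sum_list (map (\<lambda>c. length c + 1) cs)"
    unfolding A_def using assms(1)
  proof (induction es cs rule: list_induct2)
    case (Cons e es c cs)
    have "card (visits e c \<union> (\<Union>(e, c)\<in>set (zip es cs). visits e c))
      \<le> card (visits e c) + card (\<Union>(e, c)\<in>set (zip es cs). visits e c)" by (rule card_Un_le)
    with Cons card_visits[of e c] show ?case by simp
  qed simp
  moreover have "finite A" unfolding A_def by auto
  ultimately have "card ((\<lambda>y. y mod int n) ` A) < card {0..<int n}"
    using assms(2) card_image_le[of A "\<lambda>y. y mod int n"] by simp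
  then have "\<not> {0..<int n} \<subseteq> (\<lambda>y. y mod int n) ` A"
    using \<open>finite A\<close> by (meson card_mono finite_imageI not_less)
  then obtain q where "q \<in> {0..<int n}" and q': "q \<notin> (\<lambda>y. y mod int n) ` A" by blast
  then have q: "0 \<le> q" "q < int n" by auto
  have "\<not> int n dvd y - q" if "y \<in> A" for y
    using that q q' by (auto simp flip: mod_eq_dvd_iff)
  then show ?thesis unfolding A_def by (intro exI[of _ q]) auto
qed

lemma flips_mod_bdry:
  assumes "n dvd e - e'"
  shows "(\<lambda>x. flips e c x + flips e' c x) \<in> bdry n"
proof -
  have "(\<lambda>x. flips e c x + flips e c (x + (e - e'))) \<in> bdry n"
    by (rule bdry_shift_multiple) (use assms in auto)
  moreover have "flips e c (x + (e - e')) = flips e' c x" for x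
    using flips_shift[of e "e' - e" c x] by (simp add: algebra_simps)
  ultimately show ?thesis by simp
qed

lemma flips_sum_mod_bdry:
  assumes "list_all2 (\<lambda>e e'. n dvd e - e') es es'"
  shows "(\<lambda>x. flips_sum es cs x + flips_sum es' cs x) \<in> bdry n"
  using assms
proof (induction es es' arbitrary: cs rule: list_all2_induct)
  case (Cons e es e' es')
  show ?case
  proof (cases cs)
    case (Cons c cs')
    have "(\<lambda>x. (flips e c x + flips e' c x) + (flips_sum es cs' x + flips_sum es' cs' x)) \<in> bdry n"
      by (intro bdry_add flips_mod_bdry Cons.IH Cons.hyps)
    then show ?thesis by (simp add: Cons add_ac)
  qed simp
qed simp

text \<open>Moving the starts by multiples of \<open>n\<close> keeps the sum in
  \<open>bdry n\<close>. Once all starts lie between a free residue \<open>q\<close> and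
  \<open>q + n\<close>, every walk stays in between, and the sum vanishes by
  \<open>bdry_one_period\<close>.\<close>

lemma attains_0_iff:
  assumes "sum_list (map (\<lambda>c. length c + 1) cs) < n"
  shows "attains 0 cs (\<lambda>_. 0) \<longleftrightarrow> attains (int n) cs (\<lambda>_. 0)"
proof
  assume "attains 0 cs (\<lambda>_. 0)"
  then show "attains (int n) cs (\<lambda>_. 0)" by (auto simp: attains_def)
next
  assume "attains (int n) cs (\<lambda>_. 0)"
  then obtain es where len: "length es = length cs" and es: "flips_sum es cs \<in> bdry (int n)"
    by (auto simp: attains_def)
  obtain q where q: "\<forall>(e, c)\<in>set (zip es cs). \<forall>y\<in>visits e c. \<not> int n dvd y - q"
    using avoid_residue[OF len assms] by blast
  have n: "n > 0" using assms by simp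
  \<comment> \<open>The representative of \<open>e\<close> modulo \<open>n\<close> in the window
    beginning at \<open>q\<close>.\<close>
  define lift where "lift = (\<lambda>e. q + (e - q) mod int n)"
  have dvd: "int n dvd e - lift e" for e
  proof -
    have "e - lift e = (e - q) - (e - q) mod int n" by (simp add: lift_def)
    then show ?thesis by (simp only: dvd_minus_mod)
  qed
  have eq: "(\<lambda>x. flips_sum es cs x + flips_sum (map lift es) cs x) \<in> bdry (int n)"
    by (rule flips_sum_mod_bdry) (simp add: list_all2_conv_all_nth dvd)
  have "flips_sum (map lift es) cs x \<noteq> 0 \<Longrightarrow> q \<le> x \<and> x < q + int n" for x
    using len q
  proof (induction es cs rule: list_induct2)
    case (Cons e es c cs)
    show ?case
    proof (cases "flips (lift e) c x = 0")
      case False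
      have "\<not> int n dvd e - q" using Cons.prems(2) by auto
      then have "(e - q) mod int n \<noteq> 0" by (simp add: dvd_eq_mod_eq_0)
      moreover have "(e - q) mod int n \<ge> 0" using n by simp
      ultimately have "(e - q) mod int n > 0" by linarith
      with n have "q < lift e" "lift e < q + int n"
        using pos_mod_bound[of "int n" "e - q"] by (auto simp: lift_def)
      moreover have "\<not> int n dvd y - q" if "y \<in> visits (lift e) c" for y
      proof -
        have "visits (lift e) c = (\<lambda>x. x + (lift e - e)) ` visits e c"
          using visits_shift[of e "lift e - e" c] by simp
        with that obtain z where z: "z \<in> visits e c" "y = z + (lift e - e)" by auto
        have "\<not> int n dvd z - q" using Cons.prems(2) z(1) by auto
        moreover have "z - q = (y - q) + (e - lift e)" using z(2) by simp
        ultimately show ?thesis using dvd[of e] by (metis dvd_add)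
      qed
      ultimately show ?thesis using flips_confined[of "lift e" c "int n" q x] False by auto
    qed (use Cons in auto)
  qed simp
  moreover have "flips_sum (map lift es) cs \<in> bdry (int n)"
    using bdry_cong_add[OF eq] es by simp
  ultimately have "flips_sum (map lift es) cs = (\<lambda>_. 0)"
    using n by (intro bdry_one_period[of _ "int n" q]) auto
  then show "attains 0 cs (\<lambda>_. 0)"
    unfolding attains_def using len by (intro exI[of _ "map lift es"]) simp
qed

text \<open>A number in base \<open>n\<close> with \<open>m\<close> digits, \<open>D j\<close> being
  the lowest. It ranks the choices in the order in which the odometer meets them.\<close>

fun digit_val :: "nat \<Rightarrow> (nat \<Rightarrow> nat) \<Rightarrow> nat \<Rightarrow> nat \<Rightarrow> nat" where
  "digit_val n D j 0 = 0"
| "digit_val n D j (Suc m) = D j + n * digit_val n D (Suc j) m"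

lemma digit_val_inj:
  assumes "digit_val n D j m = digit_val n D' j m" "\<forall>i\<in>{j..<j + m}. D i < n" "\<forall>i\<in>{j..<j + m}. D' i < n"
    "i \<in> {j..<j + m}"
  shows "D i = D' i"
  using assms
proof (induction m arbitrary: j)
  case (Suc m)
  let ?v = "digit_val n D (Suc j) m" and ?v' = "digit_val n D' (Suc j) m"
  have D: "D j < n" "D' j < n" using Suc.prems by auto
  have eq: "D j + n * ?v = D' j + n * ?v'" using Suc.prems(1) by simp
  have "(D j + n * ?v) mod n = D j" "(D' j + n * ?v') mod n = D' j" using D by auto
  with eq have "D j = D' j" by simp
  with eq D have "?v = ?v'" by simp
  with Suc \<open>D j = D' j\<close> show ?case by (cases "i = j") auto
qed simp

lemma digit_val_less:
  assumes "\<forall>i\<in>{j..<j + m}. D i < n"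
  shows "digit_val n D j m < n ^ m"
  using assms
proof (induction m arbitrary: j)
  case (Suc m)
  have "digit_val n D (Suc j) m < n ^ m" using Suc by auto
  then have "n * (digit_val n D (Suc j) m + 1) \<le> n * n ^ m" by (intro mult_left_mono) auto
  moreover have "D j < n" using Suc.prems by auto
  ultimately show ?case by simp
qed simp

lemma digit_val_zero [simp]: "digit_val n (\<lambda>_. 0) j m = 0"
  by (induction m arbitrary: j) auto

text \<open>
  Membership in \<open>bdry n\<close> is invariant under translations, so the first conjugator may be taken
  to be trivial; the others matter only modulo \<open>n\<close>.
\<close>

definition digits_ok :: "nat \<Rightarrow> nat \<Rightarrow> (nat \<Rightarrow> nat) \<Rightarrow> bool" where
  "digits_ok n k D \<longleftrightarrow> D 1 = 0 \<and> (\<forall>i\<in>{2..<Suc k}. D i < n)"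

definition balanced :: "nat \<Rightarrow> gen letter list list \<Rightarrow> (nat \<Rightarrow> nat) \<Rightarrow> bool" where
  "balanced n cs D \<longleftrightarrow> flips_sum (map (\<lambda>i. int (D i)) [1..<Suc (length cs)]) cs \<in> bdry (int n)"

lemma attains_iff_balanced:
  assumes n: "n > 0"
  shows "attains (int n) cs (\<lambda>_. 0) \<longleftrightarrow> (\<exists>D. digits_ok n (length cs) D \<and> balanced n cs D)"
proof
  assume "attains (int n) cs (\<lambda>_. 0)"
  then obtain es where len: "length es = length cs" and es: "flips_sum es cs \<in> bdry (int n)"
    by (auto simp: attains_def)
  \<comment> \<open>A common translation brings the first start to 0.\<close>
  define es' where "es' = map (\<lambda>e. e + (- es ! 0)) es"
  define D where "D i = nat (es' ! (i - 1) mod int n)" for i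
  have "flips_sum es' cs \<in> bdry (int n)"
    unfolding es'_def flips_sum_shift using bdry_shift[OF es, of "es ! 0"] by simp
  moreover have "(\<lambda>x. flips_sum es' cs x + flips_sum (map (\<lambda>i. int (D i)) [1..<Suc (length cs)]) cs x)
    \<in> bdry (int n)"
    using n len
    by (intro flips_sum_mod_bdry) (auto simp: list_all2_conv_all_nth D_def es'_def simp del: upt.simps)
  ultimately have "balanced n cs D" unfolding balanced_def using bdry_cong_add by blast
  \<comment> \<open>For empty \<open>cs\<close> the value \<open>D 1\<close> is read beyond the end
    of \<open>es'\<close> and unspecified, so 0 is put in explicitly; otherwise it is 0
    already.\<close>
  moreover have "digits_ok n (length cs) (\<lambda>i. if i = 1 then 0 else D i)"
    using n by (auto simp: digits_ok_def D_def nat_less_iff)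
  moreover have "balanced n cs (\<lambda>i. if i = 1 then 0 else D i) = balanced n cs D"
  proof (cases cs)
    case (Cons c cs')
    then have "D 1 = 0" using len by (simp add: D_def es'_def)
    then have "(\<lambda>i. if i = 1 then 0 else D i) = D" by auto
    then show ?thesis by simp
  qed (simp add: balanced_def)
  ultimately show "\<exists>D. digits_ok n (length cs) D \<and> balanced n cs D" by blast
next
  assume "\<exists>D. digits_ok n (length cs) D \<and> balanced n cs D"
  then obtain D where "balanced n cs D" by blast
  then show "attains (int n) cs (\<lambda>_. 0)"
    unfolding attains_def balanced_def
    by (intro exI[of _ "map (\<lambda>i. int (D i)) [1..<Suc (length cs)]"]) (simp del: upt.simps)
qed

lemma balanced_cong:
  assumes "\<And>i. i \<in> {1..<Suc (length cs)} \<Longrightarrow> D i = D' i"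
  shows "balanced n cs D \<longleftrightarrow> balanced n cs D'"
  unfolding balanced_def using assms by (auto intro!: arg_cong[where f = "\<lambda>es. flips_sum es cs \<in> _"] simp del: upt.simps)

section \<open>The two passes over the word\<close>

text \<open>The state holds the gcd so far, the numbers of \<open>t\<close> and of its inverse in
  the current block, and their totals over the closed blocks. Registers hold naturals, so a
  displacement is kept as two counters, and \<open>(p - q) + (q - p)\<close> is its absolute value
  under truncated subtraction.\<close>

fun scan_letter :: "sym letter \<Rightarrow> nat \<times> nat \<times> nat \<times> nat \<times> nat \<Rightarrow> nat \<times> nat \<times> nat \<times> nat \<times> nat" where
  "scan_letter (Pos (Gen GenT)) (g, p, q, P, Q) = (g, p + 1, q, P, Q)"
| "scan_letter (Inv (Gen GenT)) (g, p, q, P, Q) = (g, p, q + 1, P, Q)"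
| "scan_letter (Pos (Var (VarZ j))) (g, p, q, P, Q) = (gcd g ((p - q) + (q - p)), 0, 0, P + p, Q + q)"
| "scan_letter _ s = s"

lemma scan_const:
  "\<exists>p' q'. fold scan_letter (map (map_letter Gen) c) (g, p, q, P, Q) = (g, p', q', P, Q)
    \<and> int p' - int q' = int p - int q + delta c"
proof (induction c arbitrary: p q rule: delta.induct)
  case (4 c)
  from 4[of "Suc p" q] show ?case by (auto simp: algebra_simps)
next
  case (5 c)
  from 5[of p "Suc q"] show ?case by (auto simp: algebra_simps)
qed auto

lemma scan_conj_prod_from:
  "\<exists>g' P' Q'. fold scan_letter (conj_prod_from j cs) (g, 0, 0, P, Q) = (g', 0, 0, P', Q')
    \<and> int g' = gcd (int g) (gcds cs) \<and> int P' - int Q' = int P - int Q + sum_list (map delta cs)"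
proof (induction cs arbitrary: j g P Q)
  case (Cons c cs)
  obtain p q where pq: "fold scan_letter (map (map_letter Gen) c) (g, 0, 0, P, Q) = (g, p, q, P, Q)"
    and d: "int p - int q = delta c"
    using scan_const[of c g 0 0 P Q] by auto
  have abs: "int ((p - q) + (q - p)) = \<bar>delta c\<bar>" using d by linarith
  have "int (gcd g ((p - q) + (q - p))) = gcd (int g) (delta c)"
    by (metis abs gcd_abs2_int gcd_int_int_eq)
  with Cons[of "Suc j" "gcd g ((p - q) + (q - p))" "P + p" "Q + q"] d show ?case
    by (auto simp: conj_word_def pq gcd.assoc)
qed auto

record walk_state =
  digits :: "nat \<Rightarrow> nat"
  lamps :: "nat set"
  pos :: nat
  carry :: nat
  radix :: nat

text \<open>
  The lamps lie on a circle of length \<open>n\<close>.  Entering a block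
  \<open>z\<^sub>j\<inverse> c\<^sub>j z\<^sub>j\<close> also performs one step of the odometer that enumerates the residues of the
  conjugators: the first digit has radix 1, the others have radix \<open>n\<close>.
\<close>

fun walk_letter :: "nat \<Rightarrow> sym letter \<Rightarrow> walk_state \<Rightarrow> walk_state" where
  "walk_letter n (Pos (Gen GenA)) s =
     s\<lparr>lamps := if pos s \<in> lamps s then lamps s - {pos s} else insert (pos s) (lamps s)\<rparr>"
| "walk_letter n (Inv (Gen GenA)) s =
     s\<lparr>lamps := if pos s \<in> lamps s then lamps s - {pos s} else insert (pos s) (lamps s)\<rparr>"
| "walk_letter n (Pos (Gen GenT)) s = s\<lparr>pos := if n \<le> pos s + 1 then 0 else pos s + 1\<rparr>"
| "walk_letter n (Inv (Gen GenT)) s = s\<lparr>pos := if pos s = 0 then n - 1 else pos s - 1\<rparr>"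
| "walk_letter n (Inv (Var (VarZ j))) s =
     (let d = digits s j + carry s in
      if d = radix s then s\<lparr>digits := (digits s)(j := 0), pos := 0, carry := 1, radix := n\<rparr>
      else s\<lparr>digits := (digits s)(j := d), pos := d, carry := 0, radix := n\<rparr>)"
| "walk_letter n _ s = s"

definition lit :: "nat set \<Rightarrow> int \<Rightarrow> bit" where
  "lit B x = (if x \<in> int ` B then 1 else 0)"

lemma lit_toggle:
  "lit (if p \<in> B then B - {p} else insert p B) x = lit B x + (if x = int p then 1 else 0)"
  by (auto simp: lit_def)

lemma lit_empty [simp]: "lit {} x = 0"
  by (simp add: lit_def)

lemma lit_bdry_iff:
  assumes "n > 0" "B \<subseteq> {..<n}"
  shows "lit B \<in> bdry (int n) \<longleftrightarrow> B = {}"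
proof
  assume "lit B \<in> bdry (int n)"
  then have "lit B = (\<lambda>_. 0)"
    using assms by (intro bdry_one_period[of _ "int n" 0]) (auto simp: lit_def split: if_splits)
  then have "x \<notin> int ` B" for x by (auto simp: lit_def fun_eq_iff split: if_splits)
  then show "B = {}" by auto
next
  assume "B = {}"
  then have "lit B = (\<lambda>_. 0)" by (simp add: fun_eq_iff)
  then show "lit B \<in> bdry (int n)" by simp
qed

text \<open>A wrap around the circle changes the position by \<open>n\<close>, hence the remaining
  toggles only by an element of \<open>bdry n\<close>. The lamps on the circle thus represent the
  true configuration modulo \<open>bdry n\<close>.\<close>

lemma walk_const:
  assumes "n > 0" "pos s < n" "lamps s \<subseteq> {..<n}"
  shows "\<exists>B p. fold (walk_letter n) (map (map_letter Gen) c) s = s\<lparr>lamps := B, pos := p\<rparr>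
    \<and> B \<subseteq> {..<n} \<and> (\<lambda>x. lit B x + (lit (lamps s) x + flips (int (pos s)) c x)) \<in> bdry (int n)"
  using assms(2,3)
proof (induction c arbitrary: s rule: delta.induct)
  case 1
  show ?case by (rule exI[of _ "lamps s"], rule exI[of _ "pos s"]) (use 1 in simp)
next
  case (2 c)
  let ?B = "if pos s \<in> lamps s then lamps s - {pos s} else insert (pos s) (lamps s)"
  have "pos (s\<lparr>lamps := ?B\<rparr>) < n" "lamps (s\<lparr>lamps := ?B\<rparr>) \<subseteq> {..<n}" using 2 by auto
  from 2(1)[OF this] obtain B p where "fold (walk_letter n) (map (map_letter Gen) c) (s\<lparr>lamps := ?B\<rparr>) = s\<lparr>lamps := B, pos := p\<rparr>"
    "B \<subseteq> {..<n}" "(\<lambda>x. lit B x + (lit ?B x + flips (int (pos s)) c x)) \<in> bdry (int n)" by auto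
  then show ?case
    by (intro exI[of _ B] exI[of _ p]) (simp add: lit_toggle add.assoc)
next
  case (3 c)
  let ?B = "if pos s \<in> lamps s then lamps s - {pos s} else insert (pos s) (lamps s)"
  have "pos (s\<lparr>lamps := ?B\<rparr>) < n" "lamps (s\<lparr>lamps := ?B\<rparr>) \<subseteq> {..<n}" using 3 by auto
  from 3(1)[OF this] obtain B p where "fold (walk_letter n) (map (map_letter Gen) c) (s\<lparr>lamps := ?B\<rparr>) = s\<lparr>lamps := B, pos := p\<rparr>"
    "B \<subseteq> {..<n}" "(\<lambda>x. lit B x + (lit ?B x + flips (int (pos s)) c x)) \<in> bdry (int n)" by auto
  then show ?case
    by (intro exI[of _ B] exI[of _ p]) (simp add: lit_toggle add.assoc)
next
  case (4 c)
  let ?p = "if n \<le> pos s + 1 then 0 else pos s + 1"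
  have "pos (s\<lparr>pos := ?p\<rparr>) < n" "lamps (s\<lparr>pos := ?p\<rparr>) \<subseteq> {..<n}" using 4 assms(1) by auto
  from 4(1)[OF this] obtain B p where B: "fold (walk_letter n) (map (map_letter Gen) c) (s\<lparr>pos := ?p\<rparr>) = s\<lparr>lamps := B, pos := p\<rparr>"
    "B \<subseteq> {..<n}" and *: "(\<lambda>x. lit B x + (lit (lamps s) x + flips (int ?p) c x)) \<in> bdry (int n)" by auto
  have "int ?p - (int (pos s) + 1) = (if n \<le> pos s + 1 then - int n else 0)" using 4(2) by auto
  then have "int n dvd int ?p - (int (pos s) + 1)" by (simp split: if_splits)
  from bdry_add[OF * flips_mod_bdry[OF this, of c]]
  have "(\<lambda>x. lit B x + (lit (lamps s) x + flips (int (pos s) + 1) c x)) \<in> bdry (int n)"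
    by (simp add: add.assoc)
  then show ?case using B by (intro exI[of _ B] exI[of _ p]) simp
next
  case (5 c)
  let ?p = "if pos s = 0 then n - 1 else pos s - 1"
  have "pos (s\<lparr>pos := ?p\<rparr>) < n" "lamps (s\<lparr>pos := ?p\<rparr>) \<subseteq> {..<n}" using 5 assms(1) by auto
  from 5(1)[OF this] obtain B p where B: "fold (walk_letter n) (map (map_letter Gen) c) (s\<lparr>pos := ?p\<rparr>) = s\<lparr>lamps := B, pos := p\<rparr>"
    "B \<subseteq> {..<n}" and *: "(\<lambda>x. lit B x + (lit (lamps s) x + flips (int ?p) c x)) \<in> bdry (int n)" by auto
  have "int n dvd int ?p - (int (pos s) - 1)" using assms(1) by (auto simp: of_nat_diff)
  from bdry_add[OF * flips_mod_bdry[OF this, of c]]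
  have "(\<lambda>x. lit B x + (lit (lamps s) x + flips (int (pos s) - 1) c x)) \<in> bdry (int n)"
    by (simp add: add.assoc)
  then show ?case using B by (intro exI[of _ B] exI[of _ p]) simp
qed

text \<open>A digit below the radix plus a carry of at most 1 leaves the range of digits only by
  hitting the radix itself, so a test for equality replaces division with remainder.\<close>

lemma walk_conj_word:
  assumes "n > 0" "digits s j < radix s" "radix s \<le> n" "carry s \<le> 1" "lamps s \<subseteq> {..<n}"
  shows "\<exists>d B p c'. fold (walk_letter n) (conj_word j c) s =
      \<lparr>digits = (digits s)(j := d), lamps = B, pos = p, carry = c', radix = n\<rparr>
    \<and> d < radix s \<and> d + c' * radix s = digits s j + carry s \<and> c' \<le> 1 \<and> B \<subseteq> {..<n}
    \<and> (\<lambda>x. lit B x + (lit (lamps s) x + flips (int d) c x)) \<in> bdry (int n)"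
proof -
  define e where "e = digits s j + carry s"
  define d where "d = (if e = radix s then 0 else e)"
  define c' :: nat where "c' = (if e = radix s then 1 else 0)"
  define t where "t = \<lparr>digits = (digits s)(j := d), lamps = lamps s, pos = d, carry = c', radix = n\<rparr>"
  have t: "walk_letter n (Inv (Var (VarZ j))) s = t"
    by (cases s) (auto simp: t_def d_def c'_def e_def Let_def)
  have d: "d < radix s" "d + c' * radix s = digits s j + carry s" "c' \<le> 1"
    using assms by (auto simp: d_def c'_def e_def)
  obtain B p where "fold (walk_letter n) (map (map_letter Gen) c) t = t\<lparr>lamps := B, pos := p\<rparr>" "B \<subseteq> {..<n}"
    "(\<lambda>x. lit B x + (lit (lamps t) x + flips (int (pos t)) c x)) \<in> bdry (int n)"
    using walk_const[of n t c] assms d by (auto simp: t_def)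
  then show ?thesis
    using d by (intro exI[of _ d] exI[of _ B] exI[of _ p] exI[of _ c'])
      (simp add: conj_word_def t del: walk_letter.simps(5), simp add: t_def)
qed

lemma digit_val_cong:
  "\<forall>i\<in>{j..<j + m}. D i = D' i \<Longrightarrow> digit_val n D j m = digit_val n D' j m"
  by (induction m arbitrary: j) auto

text \<open>Addition with carry from the lowest digit upwards: a digit is final as soon as its block
  is entered, so the block can be walked at once with the new value. The weighted carry keeps the
  count exact even at overflow.\<close>

lemma walk_conj_prod_from:
  assumes "n > 0" "radix s = n" "carry s \<le> 1" "lamps s \<subseteq> {..<n}" "\<forall>i\<in>{j..<j + length cs}. digits s i < n"
    and "t = fold (walk_letter n) (conj_prod_from j cs) s"
  shows "carry t \<le> 1 \<and> lamps t \<subseteq> {..<n} \<and> (\<forall>i\<in>{j..<j + length cs}. digits t i < n)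
    \<and> (\<forall>i. i \<notin> {j..<j + length cs} \<longrightarrow> digits t i = digits s i)
    \<and> digit_val n (digits t) j (length cs) + carry t * n ^ length cs = digit_val n (digits s) j (length cs) + carry s
    \<and> (\<lambda>x. lit (lamps t) x + (lit (lamps s) x + flips_sum (map (\<lambda>i. int (digits t i)) [j..<j + length cs]) cs x)) \<in> bdry (int n)"
  using assms(2-)
proof (induction cs arbitrary: j s)
  case (Cons c cs)
  let ?m = "length cs"
  have "digits s j < radix s" using Cons.prems by auto
  then obtain d B p c' where fold: "fold (walk_letter n) (conj_word j c) s =
      \<lparr>digits = (digits s)(j := d), lamps = B, pos = p, carry = c', radix = n\<rparr>" (is "_ = ?u")
    and d: "d < radix s" "d + c' * radix s = digits s j + carry s" "c' \<le> 1" and B: "B \<subseteq> {..<n}"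
    and bd: "(\<lambda>x. lit B x + (lit (lamps s) x + flips (int d) c x)) \<in> bdry (int n)"
    using walk_conj_word[of n s j c] Cons.prems assms(1) by auto
  have t: "t = fold (walk_letter n) (conj_prod_from (Suc j) cs) ?u"
    using Cons.prems(5) fold by simp
  have IH: "carry t \<le> 1 \<and> lamps t \<subseteq> {..<n} \<and> (\<forall>i\<in>{Suc j..<Suc j + ?m}. digits t i < n)
    \<and> (\<forall>i. i \<notin> {Suc j..<Suc j + ?m} \<longrightarrow> digits t i = digits ?u i)
    \<and> digit_val n (digits t) (Suc j) ?m + carry t * n ^ ?m = digit_val n (digits ?u) (Suc j) ?m + carry ?u
    \<and> (\<lambda>x. lit (lamps t) x + (lit (lamps ?u) x + flips_sum (map (\<lambda>i. int (digits t i)) [Suc j..<Suc j + ?m]) cs x)) \<in> bdry (int n)"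
    by (rule Cons.IH[OF _ _ _ _ t]) (use Cons.prems d B in auto)
  have tj: "digits t j = d" using IH by simp
  have upt: "[j..<j + length (c # cs)] = j # [Suc j..<Suc j + ?m]" by (simp add: upt_rec del: upt.simps)
  have val: "digit_val n (digits t) j (Suc ?m) + carry t * n ^ Suc ?m = digit_val n (digits s) j (Suc ?m) + carry s"
  proof -
    have "digit_val n (digits ?u) (Suc j) ?m = digit_val n (digits s) (Suc j) ?m"
      by (rule digit_val_cong) auto
    then have "n * (digit_val n (digits t) (Suc j) ?m + carry t * n ^ ?m) = n * (digit_val n (digits s) (Suc j) ?m + c')"
      using IH by simp
    then show ?thesis using d(2) tj Cons.prems(1) by (simp add: algebra_simps)
  qed
  have "(\<lambda>x. (lit B x + (lit (lamps s) x + flips (int d) c x))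
      + (lit (lamps t) x + (lit B x + flips_sum (map (\<lambda>i. int (digits t i)) [Suc j..<Suc j + ?m]) cs x))) \<in> bdry (int n)"
    by (rule bdry_add[OF bd]) (use IH in \<open>simp del: upt.simps\<close>)
  then have bd': "(\<lambda>x. lit (lamps t) x + (lit (lamps s) x + flips_sum (map (\<lambda>i. int (digits t i)) [j..<j + length (c # cs)]) (c # cs) x)) \<in> bdry (int n)"
    unfolding upt list.map flips_sum.simps tj by (simp add: add_ac del: upt.simps)
  have dig: "(\<forall>i\<in>{j..<j + length (c # cs)}. digits t i < n) \<and> (\<forall>i. i \<notin> {j..<j + length (c # cs)} \<longrightarrow> digits t i = digits s i)"
  proof (intro conjI ballI allI impI)
    fix i assume "i \<in> {j..<j + length (c # cs)}"
    then show "digits t i < n" using IH tj d Cons.prems(1) by (cases "i = j") auto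
  next
    fix i assume i: "i \<notin> {j..<j + length (c # cs)}"
    then have "i \<notin> {Suc j..<Suc j + ?m}" "i \<noteq> j" by auto
    with IH show "digits t i = digits s i" by simp
  qed
  show ?case using IH dig bd' val by simp
qed auto

fun is_xy :: "sym letter \<Rightarrow> bool" where
  "is_xy (Pos (Var (VarX i))) = True"
| "is_xy (Inv (Var (VarX i))) = True"
| "is_xy (Pos (Var (VarY i))) = True"
| "is_xy (Inv (Var (VarY i))) = True"
| "is_xy _ = False"

lemma is_xy_scan: "is_xy l \<Longrightarrow> scan_letter l s = s"
  by (cases l rule: is_xy.cases; cases s) auto

lemma is_xy_walk: "is_xy l \<Longrightarrow> walk_letter n l s = s"
  by (cases l rule: is_xy.cases) auto

lemma fold_scan_xy: "list_all is_xy U \<Longrightarrow> fold scan_letter U s = s"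
  by (induction U) (auto simp: is_xy_scan)

lemma fold_walk_xy: "list_all is_xy U \<Longrightarrow> fold (walk_letter n) U s = s"
  by (induction U) (auto simp: is_xy_walk)

text \<open>The initial carry 1 meets the first digit 0 with radix 1, which falls back to 0 and
  passes the carry on. So the first conjugator stays trivial while the others are advanced by one in
  base \<open>n\<close>.\<close>

lemma walk_round:
  assumes "n > 0" "cs \<noteq> []" "list_all is_xy pre" "digits_ok n (length cs) D"
    and t: "t = fold (walk_letter n) (pre @ conj_prod cs) \<lparr>digits = D, lamps = {}, pos = p, carry = 1, radix = 1\<rparr>"
  shows "digits_ok n (length cs) (digits t) \<and> carry t \<le> 1 \<and> lamps t \<subseteq> {..<n}
    \<and> digit_val n (digits t) 2 (length cs - 1) + carry t * n ^ (length cs - 1) = digit_val n D 2 (length cs - 1) + 1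
    \<and> (lamps t = {} \<longleftrightarrow> balanced n cs (digits t))"
proof -
  obtain c cs' where cs: "cs = c # cs'" using assms(2) by (cases cs) auto
  let ?s = "\<lparr>digits = D, lamps = {}, pos = p, carry = 1, radix = 1\<rparr>" and ?m = "length cs'"
  have D1: "D 1 = 0" using assms(4) by (simp add: digits_ok_def)
  obtain d B p' c' where fold: "fold (walk_letter n) (conj_word 1 c) ?s =
      \<lparr>digits = D(1 := d), lamps = B, pos = p', carry = c', radix = n\<rparr>"
    and d: "d < 1" "d + c' * 1 = D 1 + 1" and B: "B \<subseteq> {..<n}"
    and bd: "(\<lambda>x. lit B x + (lit {} x + flips (int d) c x)) \<in> bdry (int n)"
    using walk_conj_word[of n ?s 1 c] D1 assms(1) by auto
  let ?u = "\<lparr>digits = D, lamps = B, pos = p', carry = 1, radix = n\<rparr>"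
  have fold': "fold (walk_letter n) (conj_word 1 c) ?s = ?u"
    unfolding fold using d D1 by (auto simp: fun_upd_idem)
  have t': "t = fold (walk_letter n) (conj_prod_from 2 cs') ?u"
    unfolding t cs conj_prod_eq conj_prod_from_simps fold_append comp_apply fold_walk_xy[OF assms(3)] fold'
    by (simp add: numeral_2_eq_2)
  have "carry t \<le> 1 \<and> lamps t \<subseteq> {..<n} \<and> (\<forall>i\<in>{2..<2 + ?m}. digits t i < n)
    \<and> (\<forall>i. i \<notin> {2..<2 + ?m} \<longrightarrow> digits t i = digits ?u i)
    \<and> digit_val n (digits t) 2 ?m + carry t * n ^ ?m = digit_val n (digits ?u) 2 ?m + carry ?u
    \<and> (\<lambda>x. lit (lamps t) x + (lit (lamps ?u) x + flips_sum (map (\<lambda>i. int (digits t i)) [2..<2 + ?m]) cs' x)) \<in> bdry (int n)"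
    by (rule walk_conj_prod_from[OF _ _ _ _ _ t']) (use assms(1,4) B in \<open>auto simp: digits_ok_def cs\<close>)
  note T = this[simplified]
  have t1: "digits t 1 = 0" using T D1 by auto
  have "(\<lambda>x. (lit B x + (lit {} x + flips (int d) c x))
    + (lit (lamps t) x + (lit B x + flips_sum (map (\<lambda>i. int (digits t i)) [2..<2 + ?m]) cs' x))) \<in> bdry (int n)"
    by (rule bdry_add[OF bd]) (use T in simp)
  moreover have "[1..<Suc (length cs)] = 1 # [2..<2 + ?m]"
    by (simp add: cs upt_conv_Cons numeral_2_eq_2 del: upt.simps)
  ultimately have "(\<lambda>x. lit (lamps t) x + flips_sum (map (\<lambda>i. int (digits t i)) [1..<Suc (length cs)]) cs x) \<in> bdry (int n)"
    using d(1) t1 by (simp add: cs add_ac del: upt.simps)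
  from bdry_cong_add[OF this] have "lamps t = {} \<longleftrightarrow> balanced n cs (digits t)"
    using lit_bdry_iff[OF assms(1), of "lamps t"] T by (simp add: balanced_def del: upt.simps)
  then show ?thesis using T t1 by (auto simp: digits_ok_def cs)
qed

section \<open>Size estimates and the encoded input\<close>

lemma abs_delta_le: "\<bar>delta c\<bar> \<le> int (length c)"
  by (induction c rule: delta.induct) auto

lemma length_conj_word: "length (conj_word j c) = length c + 2"
  by (simp add: conj_word_def)

text \<open>Each block has two letters besides its constant. One pays for the extra position that a
  walk visits, the other makes the estimate strict as soon as there is a constant.\<close>

lemma length_conj_prod_from:
  "length (conj_prod_from j cs) = sum_list (map (\<lambda>c. length c + 1) cs) + length cs"
  by (induction cs arbitrary: j) (auto simp: length_conj_word)

lemma gcds_bounds: "0 \<le> gcds cs \<and> gcds cs \<le> int (sum_list (map (\<lambda>c. length c + 1) cs))"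
proof (induction cs)
  case (Cons c cs)
  show ?case
  proof (cases "delta c = 0")
    case False
    then have "gcd (delta c) (gcds cs) \<le> \<bar>delta c\<bar>" by (intro zdvd_imp_le) auto
    then show ?thesis using abs_delta_le[of c] Cons by simp
  qed (use Cons in auto)
qed simp

lemma abs_sum_delta_le:
  "\<bar>sum_list (map delta cs)\<bar> \<le> int (sum_list (map (\<lambda>c. length c + 1) cs))"
proof (induction cs)
  case (Cons c cs)
  then show ?case using abs_delta_le[of c] by simp
qed simp

lemma length_encode: "length (encode W) = 2 * length W"
proof -
  have "length (encode_letter l) = 2" for l by (cases l) auto
  then show ?thesis by (induction W) (auto simp: encode_def)
qed

fun kind :: "sym letter \<Rightarrow> nat" where
  "kind (Pos s) = 2 * sym_kind s"
| "kind (Inv s) = 2 * sym_kind s + 1"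

fun index :: "sym letter \<Rightarrow> nat" where
  "index (Pos s) = sym_index s"
| "index (Inv s) = sym_index s"

lemma nth_encode:
  assumes "i < length W"
  shows "encode W ! (2 * i) = kind (W ! i)" "encode W ! (2 * i + 1) = index (W ! i)"
proof -
  have "encode_letter l = [kind l, index l]" for l by (cases l) auto
  then have "encode W ! (2 * i) = kind (W ! i) \<and> encode W ! (2 * i + 1) = index (W ! i)"
    using assms
  proof (induction W arbitrary: i)
    case (Cons l W)
    then show ?case by (cases i) (auto simp: encode_def)
  qed simp
  then show "encode W ! (2 * i) = kind (W ! i)" "encode W ! (2 * i + 1) = index (W ! i)" by auto
qed

text \<open>What \<open>InRead\<close> delivers. Beyond the end this is 0, the kind of
  \<open>a\<close>, so a word that is too short never seems to contain a letter of kind 4.\<close>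

definition input_at :: "nat list \<Rightarrow> nat \<Rightarrow> nat" where
  "input_at xs i = (if i < length xs then xs ! i else 0)"

lemma input_at_encode: "input_at (encode W) (2 * i) = (if i < length W then kind (W ! i) else 0)"
  by (simp add: input_at_def length_encode nth_encode)

text \<open>The first half prevents the test for the type of the equation from being misled by a
  block; the second keeps the digits inside the registers reserved for them.\<close>

lemma kind_conj_prod_from:
  assumes "l \<in> set (conj_prod_from j cs)"
  shows "kind l \<noteq> 4" "l = Inv (Var (VarZ i)) \<Longrightarrow> i < j + length cs"
proof -
  have gen: "kind (map_letter Gen g) < 4 \<and> map_letter Gen g \<noteq> Inv (Var (VarZ i))" for g i
    by (cases g; rename_tac x; case_tac x) auto
  have "kind l \<noteq> 4 \<and> (l = Inv (Var (VarZ i)) \<longrightarrow> i < j + length cs)"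
    using assms
  proof (induction cs arbitrary: j)
    case (Cons c cs)
    then consider "l \<in> set (conj_word j c)" | "l \<in> set (conj_prod_from (Suc j) cs)" by auto
    then show ?case
    proof cases
      case 1
      then consider "l = Inv (Var (VarZ j))" | g where "l = map_letter Gen g" | "l = Pos (Var (VarZ j))"
        by (auto simp: conj_word_def)
      then show ?thesis
      proof cases
        case (2 g)
        then show ?thesis using gen[of g i] by auto
      qed auto
    qed (use Cons.IH[of "Suc j"] in auto)
  qed simp
  then show "kind l \<noteq> 4" "l = Inv (Var (VarZ i)) \<Longrightarrow> i < j + length cs" by auto
qed

lemma list_all_is_xy_comm: "list_all is_xy (comm_prod_from i m)"
  by (induction m arbitrary: i) (auto simp: comm_word_def)

lemma list_all_is_xy_square: "list_all is_xy (square_prod_from i m)"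
  by (induction m arbitrary: i) (auto simp: square_word_def)

text \<open>
  The first letter of \<open>W\<close> is some \<open>x\<^sub>i\<close> with exponent 1 exactly in type (3), and the third letter is so exactly
  in type (2) and in type (3) with at least two squares, when the prefix attains all of \<open>bdry 1\<close>.
  Letter \<open>i\<close> (counted from 0) occupies the input cells \<open>2 i\<close> and \<open>2 i + 1\<close>.
\<close>

lemma quadratic_lhs_cases:
  assumes "quadratic_lhs W k"
  obtains pre cs where "W = pre @ conj_prod cs" "length cs = k" "list_all is_xy pre" "pre \<noteq> [] \<or> cs \<noteq> []"
    "vars pre \<inter> range VarZ = {}"
    "vals pre = {(2 * d, F) |d F. d \<in> (if input_at (encode W) 0 = 4 then UNIV else {0})
      \<and> F \<in> bdry (gcd (if input_at (encode W) 4 = 4 then 1 else 0) d)}"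
proof -
  note input = input_at_encode[of W 0, simplified] input_at_encode[of W 2, simplified]
  have third: "kind (conj_prod cs ! i) \<noteq> 4" if "i < length (conj_prod cs)" for cs i
    using that unfolding conj_prod_eq by (intro kind_conj_prod_from(1)[of _ 1 cs]) auto
  from assms show ?thesis
  proof cases
    case (spherical cs)
    have "vals [] = {(2 * d, F) |d F. d \<in> {0} \<and> F \<in> bdry (gcd 0 d)}"
      by (auto simp: vals_def L2_one intro!: exI[of _ "\<lambda>_. \<one>\<^bsub>L2\<^esub>"])
    moreover have "input_at (encode W) 4 \<noteq> 4" "input_at (encode W) 0 \<noteq> 4"
      unfolding input using third[of _ cs] spherical(1) by auto
    ultimately show ?thesis
      using spherical by (intro that[of "[]" cs]) (auto simp: vars_def)
  next
    case (orientable cs g)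
    obtain m where m: "g = Suc m" using orientable by (cases g) auto
    have "input_at (encode W) 4 = 4" "input_at (encode W) 0 \<noteq> 4"
      unfolding input unfolding orientable(1) m comm_prod_eq by (simp_all add: comm_word_def)
    moreover have "vals (comm_prod g) = {(2 * d, F) |d F. d \<in> {0} \<and> F \<in> bdry (gcd 1 d)}"
      unfolding m comm_prod_eq vals_comm_prod_from by auto
    ultimately show ?thesis
      using orientable vars_comm_prod_from[of 1 g]
      by (intro that[of "comm_prod g" cs]) (auto simp: comm_prod_eq list_all_is_xy_comm m comm_word_def)
  next
    case (nonorientable cs g)
    obtain m where m: "g = Suc m" using nonorientable by (cases g) auto
    have 0: "input_at (encode W) 0 = 4"
      unfolding input unfolding nonorientable(1) m square_prod_eq by (simp add: square_word_def)
    have xy: "list_all is_xy (square_prod g)" "square_prod g \<noteq> []"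
      by (auto simp: square_prod_eq list_all_is_xy_square m square_word_def)
    have disj: "vars (square_prod g) \<inter> range VarZ = {}"
      using vars_square_prod_from[of 1 g] by (auto simp: square_prod_eq)
    show ?thesis
    proof (cases m)
      case 0
      then have eq: "square_prod g = square_word 1" by (simp add: m square_prod_eq)
      \<comment> \<open>After a single square the third letter opens the first block or lies beyond
        the end of the word.\<close>
      have "input_at (encode W) 4 \<noteq> 4"
        using third[of 0 cs] unfolding input unfolding nonorientable(1) eq by (auto simp: square_word_def)
      moreover have "vals (square_prod g) = {(2 * d, F) |d F. d \<in> UNIV \<and> F \<in> bdry (gcd 0 d)}"
        unfolding eq vals_square_word by (auto simp: abs_if)
      ultimately show ?thesis
        using nonorientable xy disj \<open>input_at (encode W) 0 = 4\<close>
        by (intro that[of "square_prod g" cs]) auto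
    next
      case (Suc m')
      have "input_at (encode W) 4 = 4"
        unfolding input unfolding nonorientable(1) m Suc square_prod_eq by (simp add: square_word_def)
      moreover have "vals (square_prod g) = {(2 * d, F) |d F. d \<in> UNIV \<and> F \<in> bdry (gcd 1 d)}"
        unfolding m Suc square_prod_eq vals_square_prod_from by auto
      ultimately show ?thesis
        using nonorientable xy disj \<open>input_at (encode W) 0 = 4\<close>
        by (intro that[of "square_prod g" cs]) auto
    qed
  qed
qed

text \<open>
  Here \<open>h\<close> is the absolute value that the exponent sum of the squared variables must have.
  A zero gcd is replaced by the length of a circle that the constants cannot cover.
\<close>

lemma solvable_iff_digits:
  assumes W: "W = pre @ conj_prod cs" and cs: "cs \<noteq> []"
    and vars: "vars pre \<inter> range VarZ = {}" and vals: "vals pre = {(2 * d, F) |d F. d \<in> (if free then UNIV else {0}) \<and> F \<in> bdry (gcd n0 d)}"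
    and n0: "n0 \<in> {0, 1}" and g: "int g = gcd n0 (gcds cs)"
    and s: "int s = \<bar>sum_list (map delta cs)\<bar>"
    and h: "h = (if free then s div 2 else 0)"
    and n: "n = (if gcd g h = 0 then length W else gcd g h)"
  shows "0 < n \<and> n \<le> length W"
    and "solvable W \<longleftrightarrow> (if free then even s else s = 0) \<and> (\<exists>D. digits_ok n (length cs) D \<and> balanced n cs D)"
proof -
  let ?l = "sum_list (map (\<lambda>c. length c + 1) cs)"
  have l: "?l < length W"
    using W cs by (simp add: conj_prod_eq length_conj_prod_from)
  show n_bounds: "0 < n \<and> n \<le> length W"
  proof (cases "gcd g h = 0")
    case False
    have "h \<le> ?l" using abs_sum_delta_le[of cs] s h by (auto split: if_splits)
    moreover have "g \<le> ?l \<or> g = 1"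
      using n0 g gcds_bounds[of cs] by auto
    moreover have "gcd g h \<le> g \<or> gcd g h \<le> h"
      using False by (metis gcd_eq_0_iff gcd_le1_nat gcd_le2_nat)
    ultimately have "gcd g h \<le> length W" using l by linarith
    then show ?thesis using False n by auto
  qed (use l n in auto)
  have attains: "attains (int (gcd g h)) cs (\<lambda>_. 0) \<longleftrightarrow> (\<exists>D. digits_ok n (length cs) D \<and> balanced n cs D)"
    using attains_0_iff[OF l] attains_iff_balanced[of n cs] n_bounds n by auto
  \<comment> \<open>The gcd does not depend on the sign of \<open>d\<close>, so the machine may work
    with absolute values.\<close>
  have gcd_eq: "gcd (gcd n0 d) (gcds cs) = int (gcd g h)" if "\<bar>d\<bar> = int h" for d
  proof -
    have "gcd (gcd n0 d) (gcds cs) = gcd (gcd n0 (gcds cs)) d" by (simp add: ac_simps)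
    also have "\<dots> = gcd (int g) (int h)" unfolding g[symmetric] that[symmetric] by simp
    finally show ?thesis by simp
  qed
  have "solvable W \<longleftrightarrow> (\<exists>d\<in>(if free then UNIV else {0}). 2 * d + sum_list (map delta cs) = 0
      \<and> attains (gcd (gcd n0 d) (gcds cs)) cs (\<lambda>_. 0))"
    unfolding W by (rule solvable_append_conj_prod[OF vars vals])
  also have "\<dots> \<longleftrightarrow> (if free then even s else s = 0) \<and> attains (int (gcd g h)) cs (\<lambda>_. 0)"
  proof (cases free)
    case True
    have "(\<exists>d. 2 * d + sum_list (map delta cs) = 0 \<and> attains (gcd (gcd n0 d) (gcds cs)) cs (\<lambda>_. 0))
      \<longleftrightarrow> even s \<and> attains (int (gcd g h)) cs (\<lambda>_. 0)"
    proof safe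
      fix d assume d: "2 * d + sum_list (map delta cs) = 0" "attains (gcd (gcd n0 d) (gcds cs)) cs (\<lambda>_. 0)"
      then have s2: "int s = 2 * \<bar>d\<bar>" using s by simp
      then have "int h = \<bar>d\<bar>" using h True by (simp add: zdiv_int)
      with d(2) gcd_eq[of d] show "attains (int (gcd g h)) cs (\<lambda>_. 0)" by simp
      show "even s" using s2 by (metis dvd_triv_left even_of_nat_iff)
    next
      assume "even s" and att: "attains (int (gcd g h)) cs (\<lambda>_. 0)"
      then have s2: "s = 2 * h" using h True by simp
      \<comment> \<open>The sign is opposite to that of the total displacement of the
        constants.\<close>
      define d where "d = (if sum_list (map delta cs) \<ge> 0 then - int h else int h)"
      have "2 * d + sum_list (map delta cs) = 0" using s s2 by (simp add: d_def split: if_splits)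
      moreover have "\<bar>d\<bar> = int h" by (simp add: d_def)
      ultimately show "\<exists>d. 2 * d + sum_list (map delta cs) = 0 \<and> attains (gcd (gcd n0 d) (gcds cs)) cs (\<lambda>_. 0)"
        using gcd_eq[of d] att by auto
    qed
    with True show ?thesis by simp
  next
    case False
    then show ?thesis using gcd_eq[of 0] h s by auto
  qed
  finally show "solvable W \<longleftrightarrow> (if free then even s else s = 0) \<and> (\<exists>D. digits_ok n (length cs) D \<and> balanced n cs D)"
    unfolding attains .
qed

text \<open>The prefix can take the trivial value. The last letter is some \<open>x_i\<close> or
  \<open>y_i\<close>, of kind below 8, and reading it reveals this case in constant time.\<close>

lemma solvable_no_constants:
  assumes "quadratic_lhs W 0"
  shows "solvable W" "W \<noteq> []" "kind (last W) < 8"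
proof -
  obtain pre cs where W: "W = pre @ conj_prod cs" "length cs = 0" "list_all is_xy pre" "pre \<noteq> [] \<or> cs \<noteq> []"
    and vals: "vals pre = {(2 * d, F) |d F. d \<in> (if input_at (encode W) 0 = 4 then UNIV else {0})
      \<and> F \<in> bdry (gcd (if input_at (encode W) 4 = 4 then 1 else 0) d)}"
    by (rule quadratic_lhs_cases[OF assms])
  have pre: "W = pre" "pre \<noteq> []" using W by (auto simp: conj_prod_def)
  have "(2 * 0, \<lambda>_. 0) \<in> vals pre" unfolding vals by (intro CollectI exI[of _ 0] exI[of _ "\<lambda>_. 0"] conjI refl) simp_all
  then show "solvable W" unfolding solvable_iff_vals pre L2_one by simp
  show "W \<noteq> []" using pre by simp
  have "is_xy (last W)" using W(3) pre by (simp add: list_all_iff)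
  then show "kind (last W) < 8" by (cases "last W" rule: is_xy.cases) auto
qed

text \<open>With constants the word ends in some \<open>z_j\<close>, so comparing the kind of the
  last letter with 7 separates the two cases.\<close>

lemma kind_last_conj_prod:
  assumes "cs \<noteq> []"
  shows "kind (last (pre @ conj_prod cs)) = 8"
proof -
  have "conj_prod_from j cs \<noteq> [] \<and> last (conj_prod_from j cs) = Pos (Var (VarZ (j + length cs - 1)))" for j
    using assms
  proof (induction cs arbitrary: j)
    case (Cons c cs)
    then show ?case by (cases "cs = []") (auto simp: conj_word_def)
  qed simp
  then show ?thesis unfolding conj_prod_eq by (simp add: last_append)
qed

section \<open>Structured programs\<close>

datatype com =
    Skip
  | Instr instr
  | Seq com com  (infixr \<open>;;\<close> 60)
  | Cond nat com com
  | While nat com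

fun is_jump :: "instr \<Rightarrow> bool" where
  "is_jump (JumpZero _ _) = True"
| "is_jump _ = False"

definition effect :: "nat list \<Rightarrow> instr \<Rightarrow> (nat \<Rightarrow> nat) \<Rightarrow> nat \<Rightarrow> nat" where
  "effect xs i R = snd (exec_instr xs i (0, R))"

text \<open>
  Register 1 is reserved for unconditional jumps; it is cleared after a taken branch and after
  every iteration of a loop, which costs two further steps.
\<close>

inductive runs :: "nat list \<Rightarrow> com \<Rightarrow> (nat \<Rightarrow> nat) \<Rightarrow> nat \<Rightarrow> (nat \<Rightarrow> nat) \<Rightarrow> bool" for xs where
  Skip: "runs xs Skip R 0 R"
| Instr: "\<not> is_jump i \<Longrightarrow> runs xs (Instr i) R 1 (effect xs i R)"
| Seq: "runs xs c R t S \<Longrightarrow> runs xs d S u T \<Longrightarrow> runs xs (c ;; d) R (t + u) T"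
| CondTrue: "R r \<noteq> 0 \<Longrightarrow> runs xs c R t S \<Longrightarrow> runs xs (Cond r c d) R (Suc (t + 2)) (S(1 := 0))"
| CondFalse: "R r = 0 \<Longrightarrow> runs xs d R t S \<Longrightarrow> runs xs (Cond r c d) R (Suc t) S"
| WhileFalse: "R r = 0 \<Longrightarrow> runs xs (While r c) R 1 R"
| WhileTrue: "R r \<noteq> 0 \<Longrightarrow> runs xs c R t S \<Longrightarrow> runs xs (While r c) (S(1 := 0)) u T \<Longrightarrow>
    runs xs (While r c) R (Suc (t + 2 + u)) T"

fun code_size :: "com \<Rightarrow> nat" where
  "code_size Skip = 0"
| "code_size (Instr i) = 1"
| "code_size (c ;; d) = code_size c + code_size d"
| "code_size (Cond r c d) = code_size c + code_size d + 3"
| "code_size (While r c) = code_size c + 3"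

text \<open>Jump targets are absolute, so the address \<open>p\<close> is handed down. The
  \<open>3\<close> counts the test and the two instructions that imitate an unconditional
  jump.\<close>

fun compile :: "nat \<Rightarrow> com \<Rightarrow> instr list" where
  "compile p Skip = []"
| "compile p (Instr i) = [i]"
| "compile p (c ;; d) = compile p c @ compile (p + code_size c) d"
| "compile p (Cond r c d) = [JumpZero r (p + code_size c + 3)] @ compile (p + 1) c
     @ [SetConst 1 0, JumpZero 1 (p + code_size c + code_size d + 3)] @ compile (p + code_size c + 3) d"
| "compile p (While r c) = [JumpZero r (p + code_size c + 3)] @ compile (p + 1) c
     @ [SetConst 1 0, JumpZero 1 p]"

lemma length_compile [simp]: "length (compile p c) = code_size c"
  by (induction c arbitrary: p) auto

lemma step_nth:
  assumes "pc < length P"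
  shows "step P xs (pc, R) = exec_instr xs (P ! pc) (pc, R)"
  using assms by (simp add: step_def halted_def)

definition reaches :: "instr list \<Rightarrow> nat list \<Rightarrow> config \<Rightarrow> nat \<Rightarrow> config \<Rightarrow> bool" where
  "reaches P xs c t d \<longleftrightarrow> (step P xs ^^ t) c = d"

lemma reaches_trans: "reaches P xs c t d \<Longrightarrow> reaches P xs d u e \<Longrightarrow> reaches P xs c (t + u) e"
  unfolding reaches_def by (subst add.commute) (simp add: funpow_add)

lemma reaches_step:
  "pc < length P \<Longrightarrow> exec_instr xs (P ! pc) (pc, R) = d \<Longrightarrow> reaches P xs (pc, R) 1 d"
  by (simp add: reaches_def step_nth)

definition code_at :: "instr list \<Rightarrow> nat \<Rightarrow> instr list \<Rightarrow> bool" where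
  "code_at P p is \<longleftrightarrow> (\<exists>U V. P = U @ is @ V \<and> length U = p)"

lemma code_at_append:
  "code_at P p (is @ js) \<longleftrightarrow> code_at P p is \<and> code_at P (p + length is) js"
proof safe
  assume "code_at P p (is @ js)"
  then obtain U V where P: "P = U @ (is @ js) @ V" "length U = p" by (auto simp: code_at_def)
  show "code_at P p is" unfolding code_at_def
    by (rule exI[of _ U], rule exI[of _ "js @ V"]) (simp add: P)
  show "code_at P (p + length is) js" unfolding code_at_def
    by (rule exI[of _ "U @ is"], rule exI[of _ V]) (simp add: P)
next
  assume "code_at P p is" "code_at P (p + length is) js"
  then obtain U V U' V' where P: "P = U @ is @ V" "length U = p" "P = U' @ js @ V'" "length U' = p + length is"
    unfolding code_at_def by blast
  have "U' = U @ is"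
    using P by (metis append_assoc append_eq_append_conv length_append)
  with P show "code_at P p (is @ js)" unfolding code_at_def
    by (intro exI[of _ U] exI[of _ V']) auto
qed

lemma code_at_Cons:
  "code_at P p (i # is) \<longleftrightarrow> p < length P \<and> P ! p = i \<and> code_at P (Suc p) is"
proof -
  have "code_at P p [i] \<longleftrightarrow> p < length P \<and> P ! p = i"
  proof
    assume "p < length P \<and> P ! p = i"
    then show "code_at P p [i]" unfolding code_at_def
      by (intro exI[of _ "take p P"] exI[of _ "drop (Suc p) P"]) (auto simp: id_take_nth_drop[symmetric])
  qed (auto simp: code_at_def)
  then show ?thesis using code_at_append[of P p "[i]" "is"] by simp
qed

lemma compile_correct:
  assumes "runs xs c R t S" "code_at P p (compile p c)"
  shows "reaches P xs (p, R) t (p + code_size c, S)"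
  using assms
proof (induction arbitrary: p rule: runs.induct)
  case (Skip R)
  show ?case by (simp add: reaches_def)
next
  case (Instr i R)
  have "exec_instr xs i (p, R) = (Suc p, effect xs i R)"
    using Instr(1) by (cases i) (auto simp: effect_def)
  then show ?case using Instr(2) by (intro reaches_step) (auto simp: code_at_Cons)
next
  case (Seq c R t S d u T)
  then have "code_at P p (compile p c)" "code_at P (p + code_size c) (compile (p + code_size c) d)"
    by (auto simp: code_at_append)
  from reaches_trans[OF Seq.IH(1)[OF this(1)] Seq.IH(2)[OF this(2)]] show ?case
    by (simp add: add.assoc)
next
  case (CondTrue R r c t S d)
  have code: "p < length P" "P ! p = JumpZero r (p + code_size c + 3)" "code_at P (Suc p) (compile (Suc p) c)"
    "Suc p + code_size c < length P" "P ! (Suc p + code_size c) = SetConst 1 0"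
    "Suc (Suc p + code_size c) < length P"
    "P ! (Suc (Suc p + code_size c)) = JumpZero 1 (p + code_size c + code_size d + 3)"
    using CondTrue.prems by (auto simp: code_at_append code_at_Cons)
  have 1: "reaches P xs (p, R) 1 (Suc p, R)"
    using code CondTrue.hyps by (intro reaches_step) auto
  have 2: "reaches P xs (Suc p + code_size c, S) 1 (Suc (Suc p + code_size c), S(1 := 0))"
    using code by (intro reaches_step) auto
  have 3: "reaches P xs (Suc (Suc p + code_size c), S(1 := 0)) 1 (p + code_size c + code_size d + 3, S(1 := 0))"
    using code by (intro reaches_step) auto
  show ?case
    using reaches_trans[OF reaches_trans[OF 1 CondTrue.IH[OF code(3)]] reaches_trans[OF 2 3]]
    by (simp add: algebra_simps fun_upd_def)
next
  case (CondFalse R r d t S c)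
  have code: "p < length P" "P ! p = JumpZero r (p + code_size c + 3)"
    "code_at P (p + code_size c + 3) (compile (p + code_size c + 3) d)"
    using CondFalse.prems by (auto simp: code_at_append code_at_Cons eval_nat_numeral)
  have "reaches P xs (p, R) 1 (p + code_size c + 3, R)"
    using code CondFalse.hyps by (intro reaches_step) auto
  from reaches_trans[OF this CondFalse.IH[OF code(3)]] show ?case by (simp add: algebra_simps)
next
  case (WhileFalse R r c)
  then show ?case by (intro reaches_step) (auto simp: code_at_append code_at_Cons)
next
  case (WhileTrue R r c t S u T)
  have code: "p < length P" "P ! p = JumpZero r (p + code_size c + 3)" "code_at P (Suc p) (compile (Suc p) c)"
    "Suc p + code_size c < length P" "P ! (Suc p + code_size c) = SetConst 1 0"
    "Suc (Suc p + code_size c) < length P" "P ! (Suc (Suc p + code_size c)) = JumpZero 1 p"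
    using WhileTrue.prems by (auto simp: code_at_append code_at_Cons)
  have 1: "reaches P xs (p, R) 1 (Suc p, R)"
    using code WhileTrue.hyps by (intro reaches_step) auto
  have 2: "reaches P xs (Suc p + code_size c, S) 1 (Suc (Suc p + code_size c), S(1 := 0))"
    using code by (intro reaches_step) auto
  have 3: "reaches P xs (Suc (Suc p + code_size c), S(1 := 0)) 1 (p, S(1 := 0))"
    using code by (intro reaches_step) auto
  show ?case
    using reaches_trans[OF reaches_trans[OF reaches_trans[OF 1 WhileTrue.IH(1)[OF code(3)]] reaches_trans[OF 2 3]]
        WhileTrue.IH(2)[OF WhileTrue.prems]]
    by (simp add: algebra_simps)
qed

text \<open>The postcondition refers to the total time, where \<open>t\<close> steps have been made before.\<close>

definition wp :: "nat list \<Rightarrow> com \<Rightarrow> (nat \<Rightarrow> (nat \<Rightarrow> nat) \<Rightarrow> bool) \<Rightarrow> nat \<Rightarrow> (nat \<Rightarrow> nat) \<Rightarrow> bool" where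
  "wp xs c Q t R \<longleftrightarrow> (\<exists>u S. runs xs c R u S \<and> Q (t + u) S)"

lemma wp_mono: "wp xs c Q t R \<Longrightarrow> (\<And>u S. Q u S \<Longrightarrow> Q' u S) \<Longrightarrow> wp xs c Q' t R"
  by (auto simp: wp_def)

inductive_cases runs_SkipE: "runs xs Skip R t S"
inductive_cases runs_InstrE: "runs xs (Instr i) R t S"
inductive_cases runs_SeqE: "runs xs (c ;; d) R t S"
inductive_cases runs_CondE: "runs xs (Cond r c d) R t S"

lemma wp_Skip [simp]: "wp xs Skip Q t R \<longleftrightarrow> Q t R"
  by (force simp: wp_def intro: runs.Skip elim: runs_SkipE)

lemma wp_Seq [simp]: "wp xs (c ;; d) Q t R \<longleftrightarrow> wp xs c (wp xs d Q) t R"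
  unfolding wp_def by (fastforce simp: add.assoc intro: runs.Seq elim!: runs_SeqE)

lemma wp_Seq_fun: "wp xs (c ;; d) Q = wp xs c (wp xs d Q)"
  by (intro ext) simp

lemma wp_effect:
  assumes "\<not> is_jump i"
  shows "wp xs (Instr i) Q t R \<longleftrightarrow> Q (Suc t) (effect xs i R)"
proof
  assume "wp xs (Instr i) Q t R"
  then show "Q (Suc t) (effect xs i R)" unfolding wp_def by (auto elim!: runs_InstrE)
next
  assume "Q (Suc t) (effect xs i R)"
  then show "wp xs (Instr i) Q t R"
    unfolding wp_def using runs.Instr[OF assms] by (intro exI[of _ 1] exI[of _ "effect xs i R"]) simp
qed

lemma wp_Instr [simp]:
  "wp xs (Instr (SetConst i n)) Q t R \<longleftrightarrow> Q (Suc t) (R(i := n))"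
  "wp xs (Instr (Add i j l)) Q t R \<longleftrightarrow> Q (Suc t) (R(i := R j + R l))"
  "wp xs (Instr (Sub i j l)) Q t R \<longleftrightarrow> Q (Suc t) (R(i := R j - R l))"
  "wp xs (Instr (Load i j)) Q t R \<longleftrightarrow> Q (Suc t) (R(i := R (R j)))"
  "wp xs (Instr (Store i j)) Q t R \<longleftrightarrow> Q (Suc t) (R(R i := R j))"
  "wp xs (Instr (InLength i)) Q t R \<longleftrightarrow> Q (Suc t) (R(i := length xs))"
  "wp xs (Instr (InRead i j)) Q t R \<longleftrightarrow> Q (Suc t) (R(i := input_at xs (R j)))"
  by (simp_all add: wp_effect effect_def input_at_def)

lemma wp_Cond [simp]:
  "wp xs (Cond r c d) Q t R \<longleftrightarrow>
    (if R r \<noteq> 0 then wp xs c (\<lambda>u S. Q (u + 2) (S(1 := 0))) (Suc t) R else wp xs d Q (Suc t) R)"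
proof (cases "R r = 0")
  case True
  show ?thesis
  proof
    assume "wp xs (Cond r c d) Q t R"
    with True show "if R r \<noteq> 0 then wp xs c (\<lambda>u S. Q (u + 2) (S(1 := 0))) (Suc t) R else wp xs d Q (Suc t) R"
      unfolding wp_def by (fastforce elim!: runs_CondE)
  next
    assume "if R r \<noteq> 0 then wp xs c (\<lambda>u S. Q (u + 2) (S(1 := 0))) (Suc t) R else wp xs d Q (Suc t) R"
    with True obtain u S where "runs xs d R u S" "Q (Suc t + u) S" by (auto simp: wp_def)
    then show "wp xs (Cond r c d) Q t R"
      unfolding wp_def using runs.CondFalse[of R r, OF True] by (intro exI[of _ "Suc u"] exI[of _ S]) simp
  qed
next
  case False
  show ?thesis
  proof
    assume "wp xs (Cond r c d) Q t R"
    with False show "if R r \<noteq> 0 then wp xs c (\<lambda>u S. Q (u + 2) (S(1 := 0))) (Suc t) R else wp xs d Q (Suc t) R"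
      unfolding wp_def by (fastforce elim!: runs_CondE)
  next
    assume "if R r \<noteq> 0 then wp xs c (\<lambda>u S. Q (u + 2) (S(1 := 0))) (Suc t) R else wp xs d Q (Suc t) R"
    with False obtain u S where "runs xs c R u S" "Q (Suc t + u + 2) (S(1 := 0))" by (auto simp: wp_def)
    then show "wp xs (Cond r c d) Q t R"
      unfolding wp_def using runs.CondTrue[of R r, OF False] by (intro exI[of _ "Suc (u + 2)"] exI[of _ "S(1 := 0)"]) simp
  qed
qed

lemma wp_While_False: "R r = 0 \<Longrightarrow> Q (Suc t) R \<Longrightarrow> wp xs (While r c) Q t R"
  unfolding wp_def by (intro exI[of _ 1] exI[of _ R]) (simp add: runs.WhileFalse[simplified])

text \<open>One unfolding of the loop; termination and running time then come from an induction on a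
  measure or on the remaining input.\<close>

lemma wp_While_True:
  assumes "R r \<noteq> 0" "wp xs c (\<lambda>u S. wp xs (While r c) Q (u + 2) (S(1 := 0))) (Suc t) R"
  shows "wp xs (While r c) Q t R"
proof -
  obtain u S v T where "runs xs c R u S" "runs xs (While r c) (S(1 := 0)) v T" "Q (Suc t + u + 2 + v) T"
    using assms(2) by (auto simp: wp_def)
  then show ?thesis
    unfolding wp_def using runs.WhileTrue[of R r xs c u S v T] assms(1)
    by (intro exI[of _ "Suc (u + 2 + v)"] exI[of _ T]) (auto simp: algebra_simps)
qed

lemma answers_within_compile:
  assumes "wp xs c (\<lambda>t R. t \<le> T \<and> R 0 = (if b then 1 else 0)) 0 (\<lambda>_. 0)"
  shows "answers_within (compile 0 c) xs T b"
proof -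
  obtain t S where r: "runs xs c (\<lambda>_. 0) t S" and S: "t \<le> T" "S 0 = (if b then 1 else 0)"
    using assms by (auto simp: wp_def)
  have "code_at (compile 0 c) 0 (compile 0 c)" by (auto simp: code_at_def)
  from compile_correct[OF r this] have "run (compile 0 c) xs t = (code_size c, S)"
    by (simp add: reaches_def run_def)
  then show ?thesis unfolding answers_within_def using S by (intro exI[of _ t]) (simp add: halted_def)
qed

section \<open>The program\<close>

text \<open>Scalars live in registers up to 25, arrays from 30 on. Register 8 is to hold 1
  throughout, since addition and subtraction take only registers as operands.\<close>

abbreviation (input) ANS :: nat where "ANS \<equiv> 0"
abbreviation (input) LEN :: nat where "LEN \<equiv> 2"
abbreviation (input) IDX :: nat where "IDX \<equiv> 3"
abbreviation (input) KIND :: nat where "KIND \<equiv> 4"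
abbreviation (input) INDEX :: nat where "INDEX \<equiv> 5"
abbreviation (input) TEST :: nat where "TEST \<equiv> 6"
abbreviation (input) TMP :: nat where "TMP \<equiv> 7"
abbreviation (input) ONE :: nat where "ONE \<equiv> 8"
abbreviation (input) MODULUS :: nat where "MODULUS \<equiv> 9"
abbreviation (input) M :: nat where "M \<equiv> 10"
abbreviation (input) UP :: nat where "UP \<equiv> 11"
abbreviation (input) DOWN :: nat where "DOWN \<equiv> 12"
abbreviation (input) UPS :: nat where "UPS \<equiv> 13"
abbreviation (input) DOWNS :: nat where "DOWNS \<equiv> 14"
abbreviation (input) BASE :: nat where "BASE \<equiv> 16"
abbreviation (input) POS :: nat where "POS \<equiv> 17"
abbreviation (input) CARRY :: nat where "CARRY \<equiv> 18"
abbreviation (input) RADIX :: nat where "RADIX \<equiv> 19"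
abbreviation (input) ACC :: nat where "ACC \<equiv> 20"
abbreviation (input) GO :: nat where "GO \<equiv> 21"
abbreviation (input) TMP2 :: nat where "TMP2 \<equiv> 22"
abbreviation (input) DIG :: nat where "DIG \<equiv> 23"
abbreviation (input) FREE :: nat where "FREE \<equiv> 24"
abbreviation (input) ADDR :: nat where "ADDR \<equiv> 25"

abbreviation (input) set_const :: "nat \<Rightarrow> nat \<Rightarrow> com" where "set_const i n \<equiv> Instr (SetConst i n)"
abbreviation (input) add :: "nat \<Rightarrow> nat \<Rightarrow> nat \<Rightarrow> com" where "add i j l \<equiv> Instr (Add i j l)"
abbreviation (input) sub :: "nat \<Rightarrow> nat \<Rightarrow> nat \<Rightarrow> com" where "sub i j l \<equiv> Instr (Sub i j l)"

fun switch :: "com list \<Rightarrow> com" where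
  "switch [] = Skip"
| "switch (c # cs) = Cond KIND (sub KIND KIND ONE ;; switch cs) c"

text \<open>\<open>KIND\<close> is counted down through nested conditionals: each level costs a test
  and a subtraction on the way in and two steps on the way out. The chosen branch finds
  \<open>KIND\<close> at 0.\<close>

lemma wp_switch:
  assumes "R KIND = k" "R ONE = 1" "k < length cs"
    "wp xs (cs ! k) (\<lambda>u S. Q (u + 2 * k) (if k = 0 then S else S(1 := 0))) (t + 2 * k + 1) (R(KIND := 0))"
  shows "wp xs (switch cs) Q t R"
  using assms
proof (induction cs arbitrary: k t R Q)
  case (Cons c cs)
  show ?case
  proof (cases k)
    case 0
    then have "R(KIND := 0) = R" using Cons.prems(1) by (auto simp: fun_upd_idem)
    with 0 Cons.prems show ?thesis by simp
  next
    case (Suc k')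
    have "wp xs (cs ! k') (\<lambda>u S. Q (u + 2 * k) (S(1 := 0))) (t + 2 * k + 1) (R(KIND := 0))"
      using Cons.prems(4) Suc by (simp del: fun_upd_apply)
    then have "wp xs (cs ! k') (\<lambda>u S. Q (u + 2 * k' + 2) ((if k' = 0 then S else S(1 := 0))(1 := 0)))
        (t + 2 + 2 * k' + 1) (R(KIND := 0))"
      by (simp add: Suc del: fun_upd_apply, elim wp_mono) (auto simp del: fun_upd_apply)
    then have "wp xs (switch cs) (\<lambda>u S. Q (u + 2) (S(1 := 0))) (t + 2) (R(KIND := k'))"
      by (intro Cons.IH[of _ k']) (use Suc Cons.prems in \<open>auto simp del: fun_upd_apply simp: fun_upd_same fun_upd_other\<close>)
    then show ?thesis using Suc Cons.prems by simp
  qed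
qed simp

definition each_letter :: "com \<Rightarrow> com" where
  "each_letter c = set_const IDX 0 ;; sub TEST LEN IDX ;;
     While TEST (Instr (InRead KIND IDX) ;; add IDX IDX ONE ;; Instr (InRead INDEX IDX) ;; add IDX IDX ONE ;;
       c ;; sub TEST LEN IDX)"

text \<open>\<open>pot\<close> is a potential function, so that only the amortised cost of a letter must be bounded.\<close>

lemma wp_each_letter:
  fixes rel :: "'s \<Rightarrow> (nat \<Rightarrow> nat) \<Rightarrow> bool"
  assumes body: "\<And>l s t R. l \<in> set W \<Longrightarrow> rel s R \<Longrightarrow> R KIND = kind l \<Longrightarrow> R INDEX = index l \<Longrightarrow>
      wp (encode W) c (\<lambda>u S. u + pot (f l s) \<le> t + C + pot s \<and> rel (f l s) S \<and> S IDX = R IDX) t R"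
    and frame: "\<And>s R i v. i \<in> {1, IDX, KIND, INDEX, TEST} \<Longrightarrow> rel s R \<Longrightarrow> rel s (R(i := v))"
    and regs: "\<And>s R. rel s R \<Longrightarrow> R LEN = 2 * length W \<and> R ONE = 1"
    and init: "rel s R"
    and post: "\<And>u S. u + pot (fold f W s) \<le> t + 3 + (C + 8) * length W + pot s \<Longrightarrow> rel (fold f W s) S \<Longrightarrow> Q u S"
  shows "wp (encode W) (each_letter c) Q t R"
proof -
  have loop: "wp (encode W) (While TEST (Instr (InRead KIND IDX) ;; add IDX IDX ONE ;; Instr (InRead INDEX IDX) ;; add IDX IDX ONE ;;
       c ;; sub TEST LEN IDX)) Q t R"
    if "W = U @ V" "R IDX = 2 * length U" "R TEST = R LEN - R IDX" "rel s R"
      "\<And>u S. u + pot (fold f V s) \<le> t + 1 + (C + 8) * length V + pot s \<Longrightarrow> rel (fold f V s) S \<Longrightarrow> Q u S"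
    for U V R s t
    using that
  proof (induction V arbitrary: U R s t)
    case Nil
    have "R TEST = 0" using Nil regs[of s R] by simp
    then show ?case using Nil(4) Nil(5)[of "Suc t" R] by (intro wp_While_False) auto
  next
    case (Cons l V)
    have L: "R LEN = 2 * length W" "R ONE = 1" using regs[OF Cons.prems(4)] by auto
    have W: "length U < length W" "W ! length U = l" "l \<in> set W" using Cons.prems(1) by auto
    have in1: "input_at (encode W) (2 * length U) = kind l"
      using input_at_encode[of W "length U"] W by simp
    have in2: "input_at (encode W) (Suc (2 * length U)) = index l"
      using nth_encode(2)[of "length U" W] W by (simp add: input_at_def length_encode)
    let ?R = "R(KIND := kind l, IDX := 2 * length U + 1, INDEX := index l, IDX := 2 * length U + 2)"
    have rel: "rel s ?R" by (intro frame Cons.prems(4)) auto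
    show ?case
    proof (rule wp_While_True)
      show "R TEST \<noteq> 0" using Cons.prems L W by simp
      have "wp (encode W) c (\<lambda>u S. u + pot (f l s) \<le> Suc t + 4 + C + pot s \<and> rel (f l s) S \<and> S IDX = ?R IDX) (Suc (Suc (Suc (Suc (Suc t))))) ?R"
        by (rule wp_mono[OF body[OF W(3) rel]]) auto
      then have "wp (encode W) c (wp (encode W) (sub TEST LEN IDX) (\<lambda>u S. wp (encode W)
           (While TEST (Instr (InRead KIND IDX) ;; add IDX IDX ONE ;; Instr (InRead INDEX IDX) ;; add IDX IDX ONE ;; c ;; sub TEST LEN IDX))
           Q (u + 2) (S(1 := 0)))) (Suc (Suc (Suc (Suc (Suc t))))) ?R"
      proof (rule wp_mono)
        fix u S assume S: "u + pot (f l s) \<le> Suc t + 4 + C + pot s \<and> rel (f l s) S \<and> S IDX = ?R IDX"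
        have "wp (encode W) (While TEST (Instr (InRead KIND IDX) ;; add IDX IDX ONE ;; Instr (InRead INDEX IDX) ;; add IDX IDX ONE ;; c ;; sub TEST LEN IDX))
           Q (Suc u + 2) (S(TEST := S LEN - S IDX, 1 := 0))"
        proof (rule Cons.IH[of "U @ [l]" _ "f l s"])
          show "rel (f l s) (S(TEST := S LEN - S IDX, 1 := 0))" using S by (intro frame) auto
        next
          fix v T assume v: "v + pot (fold f V (f l s)) \<le> Suc u + 2 + 1 + (C + 8) * length V + pot (f l s)"
            and T: "rel (fold f V (f l s)) T"
          show "Q v T" by (rule Cons.prems(5)) (use v S T in auto)
        qed (use Cons.prems(1) S in auto)
        then show "wp (encode W) (sub TEST LEN IDX) (\<lambda>u S. wp (encode W)
           (While TEST (Instr (InRead KIND IDX) ;; add IDX IDX ONE ;; Instr (InRead INDEX IDX) ;; add IDX IDX ONE ;; c ;; sub TEST LEN IDX))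
           Q (u + 2) (S(1 := 0))) u S" by simp
      qed
      then show "wp (encode W) (Instr (InRead KIND IDX) ;; add IDX IDX ONE ;; Instr (InRead INDEX IDX) ;; add IDX IDX ONE ;;
          c ;; sub TEST LEN IDX) (\<lambda>u S. wp (encode W)
           (While TEST (Instr (InRead KIND IDX) ;; add IDX IDX ONE ;; Instr (InRead INDEX IDX) ;; add IDX IDX ONE ;; c ;; sub TEST LEN IDX))
           Q (u + 2) (S(1 := 0))) (Suc t) R"
        by (simp add: Cons.prems(2) L in1 in2)
    qed
  qed
  have "wp (encode W) (While TEST (Instr (InRead KIND IDX) ;; add IDX IDX ONE ;; Instr (InRead INDEX IDX) ;; add IDX IDX ONE ;;
       c ;; sub TEST LEN IDX)) Q (t + 2) (R(IDX := 0, TEST := R LEN))"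
  proof (rule loop[of "[]" W])
    show "rel s (R(IDX := 0, TEST := R LEN))" by (intro frame init) auto
  next
    fix u S assume "u + pot (fold f W s) \<le> t + 2 + 1 + (C + 8) * length W + pot s" "rel (fold f W s) S"
    then show "Q u S" by (intro post) auto
  qed auto
  then show ?thesis by (simp add: each_letter_def)
qed

text \<open>One iteration replaces the pair \<open>(n, m)\<close> by \<open>(\<bar>n - m\<bar>, min n m)\<close>.\<close>

definition gcd_loop :: com where
  "gcd_loop = While M (sub TMP MODULUS M ;; sub TMP2 M MODULUS ;; sub M MODULUS TMP ;; add MODULUS TMP TMP2)"

lemma gcd_step: "gcd ((n - m) + (m - n)) (n - (n - m)) = gcd n (m::nat)"
proof (cases "m \<le> n")
  case True
  then show ?thesis by (simp add: gcd_diff1_nat)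
next
  case False
  then show ?thesis using gcd_diff1_nat[of n m] by (simp add: gcd.commute)
qed

text \<open>The measure \<open>n + 2 * m\<close> drops in every iteration, whichever number is
  larger, and an iteration takes 7 steps. The unspent \<open>7 * S MODULUS\<close> is credit for the
  next call.\<close>

lemma wp_gcd_loop:
  assumes "\<And>u S. u + 7 * S MODULUS \<le> t + 1 + 7 * (R MODULUS + 2 * R M) \<Longrightarrow> S MODULUS = gcd (R MODULUS) (R M) \<Longrightarrow>
    (\<forall>i. i \<notin> {1, TMP, MODULUS, M, TMP2} \<longrightarrow> S i = R i) \<Longrightarrow> Q u S"
  shows "wp xs gcd_loop Q t R"
  using assms
proof (induction "R MODULUS + 2 * R M" arbitrary: R t rule: less_induct)
  case less
  show ?case
  proof (cases "R M = 0")
    case True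
    then show ?thesis unfolding gcd_loop_def by (intro wp_While_False less.prems) auto
  next
    case False
    define R' where "R' = R(TMP := R MODULUS - R M, TMP2 := R M - R MODULUS, M := R MODULUS - (R MODULUS - R M),
      MODULUS := (R MODULUS - R M) + (R M - R MODULUS), 1 := 0)"
    have dec: "R' MODULUS + 2 * R' M < R MODULUS + 2 * R M" using False by (auto simp: R'_def)
    have "wp xs gcd_loop Q (t + 7) R'"
    proof (rule less.hyps[OF dec])
      fix u S assume *: "u + 7 * S MODULUS \<le> t + 7 + 1 + 7 * (R' MODULUS + 2 * R' M)" "S MODULUS = gcd (R' MODULUS) (R' M)"
        "\<forall>i. i \<notin> {1, TMP, MODULUS, M, TMP2} \<longrightarrow> S i = R' i"
      show "Q u S"
      proof (rule less.prems)
        show "u + 7 * S MODULUS \<le> t + 1 + 7 * (R MODULUS + 2 * R M)" using *(1) dec by simp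
        show "S MODULUS = gcd (R MODULUS) (R M)" using *(2) gcd_step[of "R MODULUS" "R M"] by (simp add: R'_def)
        show "\<forall>i. i \<notin> {1, TMP, MODULUS, M, TMP2} \<longrightarrow> S i = R i" using *(3) by (auto simp: R'_def)
      qed
    qed
    then show ?thesis using False unfolding gcd_loop_def
      by (intro wp_While_True) (auto simp: R'_def eval_nat_numeral)
  qed
qed

text \<open>There is no halving instruction: \<open>M\<close> grows until \<open>2 * M\<close>
  reaches \<open>ACC\<close>, and the excess is the parity.\<close>

definition halve_loop :: com where
  "halve_loop = set_const M 0 ;; sub TEST ACC M ;;
     While TEST (add M M ONE ;; add TMP M M ;; sub TEST ACC TMP) ;;
     add TMP M M ;; sub ACC TMP ACC"

lemma wp_halve_loop:
  assumes "R ONE = 1"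
    and "\<And>u S. u \<le> t + 10 + 6 * R ACC \<Longrightarrow> S M = (R ACC + 1) div 2 \<Longrightarrow> S ACC = R ACC mod 2 \<Longrightarrow>
    (\<forall>i. i \<notin> {1, TMP, M, TEST, ACC} \<longrightarrow> S i = R i) \<Longrightarrow> Q u S"
  shows "wp xs halve_loop Q t R"
proof -
  let ?s = "R ACC"
  have loop: "wp xs (While TEST (add M M ONE ;; add TMP M M ;; sub TEST ACC TMP)) (wp xs (add TMP M M ;; sub ACC TMP ACC) Q) t' R'"
    if "R' ONE = 1" "R' TEST = ?s - 2 * R' M" "2 * R' M \<le> ?s + 1" "R' ACC = ?s"
      "\<forall>i. i \<notin> {1, TMP, M, TEST, ACC} \<longrightarrow> R' i = R i" "t' + 6 * R' TEST \<le> t + 6 * ?s + 2" for R' t'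
    using that
  proof (induction "R' TEST" arbitrary: R' t' rule: less_induct)
    case less
    show ?case
    proof (cases "R' TEST = 0")
      case True
      have "2 * R' M = ?s \<or> 2 * R' M = ?s + 1" using less.prems True by linarith
      then have "R' M = (?s + 1) div 2 \<and> R' M + R' M - ?s = ?s mod 2" by presburger
      then have "Q (t' + 3) (R'(TMP := R' M + R' M, ACC := R' M + R' M - ?s))"
        using less.prems True by (intro assms(2)) auto
      then show ?thesis using True less.prems by (intro wp_While_False) (auto simp: eval_nat_numeral)
    next
      case False
      let ?R = "R'(M := R' M + 1, TMP := 2 * R' M + 2, TEST := ?s - (2 * R' M + 2), 1 := 0)"
      have "wp xs (While TEST (add M M ONE ;; add TMP M M ;; sub TEST ACC TMP)) (wp xs (add TMP M M ;; sub ACC TMP ACC) Q) (t' + 6) ?R"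
        by (rule less.hyps) (use less.prems False in auto)
      then show ?thesis using False less.prems
        by (intro wp_While_True) (auto simp: eval_nat_numeral)
    qed
  qed
  have "wp xs (While TEST (add M M ONE ;; add TMP M M ;; sub TEST ACC TMP)) (wp xs (add TMP M M ;; sub ACC TMP ACC) Q) (t + 2)
      (R(M := 0, TEST := ?s))"
    by (rule loop) (use assms(1) in auto)
  then show ?thesis by (simp add: halve_loop_def)
qed

section \<open>The first pass: gcd and total displacement\<close>

definition scan_body :: com where
  "scan_body = switch [Skip, Skip, add UP UP ONE, add DOWN DOWN ONE, Skip, Skip, Skip, Skip,
     add UPS UPS UP ;; add DOWNS DOWNS DOWN ;; sub M UP DOWN ;; sub TMP DOWN UP ;; add M M TMP ;;
       gcd_loop ;; set_const UP 0 ;; set_const DOWN 0,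
     Skip]"

definition scan_regs :: "nat set" where
  "scan_regs = {1, IDX, KIND, INDEX, TEST, TMP, MODULUS, M, UP, DOWN, UPS, DOWNS, TMP2}"

fun scan_rel :: "(nat \<Rightarrow> nat) \<Rightarrow> nat \<times> nat \<times> nat \<times> nat \<times> nat \<Rightarrow> (nat \<Rightarrow> nat) \<Rightarrow> bool" where
  "scan_rel R0 (g, p, q, P, Q) R \<longleftrightarrow> R MODULUS = g \<and> R UP = p \<and> R DOWN = q \<and> R UPS = P \<and> R DOWNS = Q
     \<and> (\<forall>i. i \<notin> scan_regs \<longrightarrow> R i = R0 i)"

text \<open>A gcd call on \<open>g\<close> and \<open>\<bar>p - q\<bar>\<close> is charged
  \<open>7 * (g + 2 * \<bar>p - q\<bar>)\<close>; every \<open>t\<close> or inverse of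
  \<open>t\<close> in the block saves 14 for it in advance. Thus all gcds of the pass together take
  linear time.\<close>

fun scan_pot :: "nat \<times> nat \<times> nat \<times> nat \<times> nat \<Rightarrow> nat" where
  "scan_pot (g, p, q, P, Q) = 7 * g + 14 * (p + q)"

lemma scan_rel_frame:
  "i \<in> {1, IDX, KIND, INDEX, TEST} \<Longrightarrow> scan_rel R0 s R \<Longrightarrow> scan_rel R0 s (R(i := v))"
  by (cases s) (auto simp: scan_regs_def)

lemma kind_cases:
  obtains (A) "l = Pos (Gen GenA)" "kind l = 0" | (A') "l = Inv (Gen GenA)" "kind l = 1"
  | (T) "l = Pos (Gen GenT)" "kind l = 2" | (T') "l = Inv (Gen GenT)" "kind l = 3"
  | (XY) "is_xy l" "kind l \<in> {4, 5, 6, 7}"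
  | (Z) j where "l = Pos (Var (VarZ j))" "kind l = 8"
  | (Z') j where "l = Inv (Var (VarZ j))" "kind l = 9" "index l = j"
  by (cases l; rename_tac s; case_tac s; rename_tac y; case_tac y) (use that in auto)

lemma wp_scan_body:
  assumes rel: "scan_rel R0 s R" and K: "R KIND = kind l" and one: "R0 ONE = 1"
  shows "wp xs scan_body (\<lambda>u S. u + scan_pot (scan_letter l s) \<le> t + 70 + scan_pot s
    \<and> scan_rel R0 (scan_letter l s) S \<and> S IDX = R IDX) t R"
proof -
  obtain g p q P Q where s: "s = (g, p, q, P, Q)" by (cases s)
  have r: "R MODULUS = g" "R UP = p" "R DOWN = q" "R UPS = P" "R DOWNS = Q"
    and fr: "\<And>i. i \<notin> scan_regs \<Longrightarrow> R i = R0 i"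
    using rel s by auto
  have one': "R ONE = 1" using fr[of ONE] one by (simp add: scan_regs_def)
  note sw = wp_switch[OF K one', of _ xs, unfolded length_Cons list.size]
  show ?thesis
  proof (cases l rule: kind_cases)
    case A
    show ?thesis unfolding scan_body_def by (rule sw) (use A s r fr in \<open>auto simp: scan_regs_def\<close>)
  next
    case A'
    show ?thesis unfolding scan_body_def by (rule sw) (use A' s r fr in \<open>auto simp: scan_regs_def\<close>)
  next
    case T
    show ?thesis unfolding scan_body_def by (rule sw) (use T s r fr one' in \<open>auto simp: scan_regs_def\<close>)
  next
    case T'
    show ?thesis unfolding scan_body_def by (rule sw) (use T' s r fr one' in \<open>auto simp: scan_regs_def\<close>)
  next
    case XY
    show ?thesis unfolding scan_body_def by (rule sw) (use XY s r fr in \<open>auto simp: scan_regs_def is_xy_scan\<close>)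
  next
    case (Z j)
    show ?thesis unfolding scan_body_def
      by (rule sw) (use Z in simp, simp add: Z, rule wp_gcd_loop, use s r fr in \<open>auto simp: scan_regs_def Z\<close>)
  next
    case (Z' j)
    show ?thesis unfolding scan_body_def by (rule sw) (use Z' s r fr in \<open>auto simp: scan_regs_def\<close>)
  qed
qed

section \<open>The second pass: lamps on the circle and the odometer\<close>

definition toggle :: com where
  "toggle = add ADDR BASE POS ;; Instr (Load TMP ADDR) ;; sub TMP ONE TMP ;; Instr (Store ADDR TMP)"

text \<open>The sum of the two truncated differences is 0 exactly when the increased digit equals
  the radix. There is no copy instruction; values are copied by adding \<open>M\<close> after it has
  been cleared.\<close>

definition next_digit :: com where
  "next_digit = add ADDR DIG INDEX ;; Instr (Load TMP ADDR) ;; add TMP TMP CARRY ;;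
     sub M RADIX TMP ;; sub TMP2 TMP RADIX ;; add M M TMP2 ;;
     Cond M (set_const CARRY 0) (set_const CARRY 1 ;; set_const TMP 0) ;;
     Instr (Store ADDR TMP) ;; set_const M 0 ;; add POS TMP M ;; add RADIX MODULUS M"

definition walk_body :: com where
  "walk_body = switch [toggle, toggle,
     add POS POS ONE ;; sub TMP MODULUS POS ;; Cond TMP Skip (set_const POS 0),
     Cond POS (sub POS POS ONE) (sub POS MODULUS ONE),
     Skip, Skip, Skip, Skip, Skip, next_digit]"

text \<open>Digit \<open>j\<close> is stored in register \<open>30 + j\<close>, and lamp \<open>p\<close> in register \<open>L + 31 + p\<close>.\<close>

definition walk_rel :: "nat \<Rightarrow> nat \<Rightarrow> nat \<Rightarrow> walk_state \<Rightarrow> (nat \<Rightarrow> nat) \<Rightarrow> bool" where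
  "walk_rel L n a s R \<longleftrightarrow> R ANS = a \<and> R LEN = L \<and> R ONE = 1 \<and> R MODULUS = n \<and> R BASE = L + 31 \<and> R DIG = 30
     \<and> R POS = pos s \<and> R CARRY = carry s \<and> R RADIX = radix s
     \<and> (\<forall>j\<le>L. R (30 + j) = digits s j) \<and> (\<forall>p. R (L + 31 + p) = of_bool (p \<in> lamps s))"

lemma walk_rel_frame:
  "i \<in> {1, IDX, KIND, INDEX, TEST} \<Longrightarrow> walk_rel L n a s R \<Longrightarrow> walk_rel L n a s (R(i := v))"
  by (auto simp: walk_rel_def)

lemma wp_walk_body:
  assumes rel: "walk_rel L n a s R" and K: "R KIND = kind l" and I: "R INDEX = index l"
    and bound: "\<And>j. l = Inv (Var (VarZ j)) \<Longrightarrow> j \<le> L"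
  shows "wp xs walk_body (\<lambda>u S. u + 0 \<le> t + 60 + 0 \<and> walk_rel L n a (walk_letter n l s) S \<and> S IDX = R IDX) t R"
proof -
  have r: "R ANS = a" "R LEN = L" "R ONE = 1" "R MODULUS = n" "R BASE = L + 31" "R DIG = 30"
    "R POS = pos s" "R CARRY = carry s" "R RADIX = radix s"
    and dig: "\<And>j. j \<le> L \<Longrightarrow> R (30 + j) = digits s j"
    and lamp: "\<And>p. R (L + 31 + p) = of_bool (p \<in> lamps s)"
    using rel by (auto simp: walk_rel_def)
  note sw = wp_switch[OF K r(3), of _ xs, unfolded length_Cons list.size]
  show ?thesis
  proof (cases l rule: kind_cases)
    case A
    show ?thesis unfolding walk_body_def
      by (rule sw) (use A r dig lamp in \<open>auto simp: walk_rel_def toggle_def\<close>)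
  next
    case A'
    show ?thesis unfolding walk_body_def
      by (rule sw) (use A' r dig lamp in \<open>auto simp: walk_rel_def toggle_def\<close>)
  next
    case T
    show ?thesis unfolding walk_body_def
      by (rule sw) (use T r dig lamp in \<open>auto simp: walk_rel_def\<close>)
  next
    case T'
    show ?thesis unfolding walk_body_def
      by (rule sw) (use T' r dig lamp in \<open>auto simp: walk_rel_def\<close>)
  next
    case XY
    show ?thesis unfolding walk_body_def
      by (rule sw) (use XY r dig lamp in \<open>auto simp: walk_rel_def is_xy_walk\<close>)
  next
    case (Z j)
    show ?thesis unfolding walk_body_def
      by (rule sw) (use Z r dig lamp in \<open>auto simp: walk_rel_def\<close>)
  next
    case (Z' j)
    have j: "j \<le> L" using bound Z' by simp
    \<comment> \<open>Digits end at register \<open>30 + L\<close>, so storing one cannot touch a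
      lamp.\<close>
    then have ne: "L + 31 + p \<noteq> 30 + j" for p by simp
    show ?thesis unfolding walk_body_def
      by (rule sw) (use Z' r dig lamp I j ne in \<open>auto simp: walk_rel_def next_digit_def Let_def\<close>)
  qed
qed

text \<open>One sweep serves two purposes: \<open>ACC\<close> counts the lamps still lit, which
  decides whether the current choice is a solution, and the circle is dark again for the next
  round.\<close>

definition clear_lamps :: com where
  "clear_lamps = set_const ACC 0 ;; set_const IDX 0 ;; sub TEST MODULUS IDX ;;
     While TEST (add ADDR BASE IDX ;; Instr (Load TMP ADDR) ;; add ACC ACC TMP ;; set_const TMP 0 ;;
       Instr (Store ADDR TMP) ;; add IDX IDX ONE ;; sub TEST MODULUS IDX)"

lemma wp_clear_lamps:
  assumes rel: "walk_rel L n a s R" and sub: "lamps s \<subseteq> {..<n}"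
    and post: "\<And>u S. u \<le> t + 4 + 10 * n \<Longrightarrow> walk_rel L n a (s\<lparr>lamps := {}\<rparr>) S \<Longrightarrow> (S ACC = 0 \<longleftrightarrow> lamps s = {}) \<Longrightarrow> Q u S"
  shows "wp xs clear_lamps Q t R"
proof -
  let ?loop = "While TEST (add ADDR BASE IDX ;; Instr (Load TMP ADDR) ;; add ACC ACC TMP ;; set_const TMP 0 ;;
       Instr (Store ADDR TMP) ;; add IDX IDX ONE ;; sub TEST MODULUS IDX)"
  have loop: "wp xs ?loop Q t' R'"
    if "walk_rel L n a (s\<lparr>lamps := {p \<in> lamps s. i \<le> p}\<rparr>) R'" "R' IDX = i" "i \<le> n" "R' TEST = n - i"
      "R' ACC = 0 \<longleftrightarrow> {p \<in> lamps s. p < i} = {}" "t' + 10 * (n - i) = t + 3 + 10 * n" for i R' t'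
    using that
  proof (induction "n - i" arbitrary: i R' t')
    case 0
    have "{p \<in> lamps s. i \<le> p} = {}" "{p \<in> lamps s. p < i} = lamps s" using sub 0 by auto
    with 0 show ?case by (intro wp_While_False post) auto
  next
    case (Suc m)
    note rel' = Suc.prems(1)[unfolded walk_rel_def, simplified]
    have i: "i < n" using Suc.hyps(2) by simp
    have m: "m = n - Suc i" using Suc.hyps(2) by simp
    let ?R = "R'(ADDR := L + 31 + i, ACC := R' ACC + of_bool (i \<in> lamps s), TMP := 0, L + 31 + i := 0, IDX := i + 1,
      TEST := n - (i + 1), 1 := 0)"
    have "wp xs ?loop Q (t' + 10) ?R"
    proof (rule Suc.hyps(1)[OF m])
      show "walk_rel L n a (s\<lparr>lamps := {p \<in> lamps s. Suc i \<le> p}\<rparr>) ?R"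
        using rel' by (auto simp: walk_rel_def)
      have "{p \<in> lamps s. p < Suc i} = {p \<in> lamps s. p < i} \<union> {p \<in> lamps s. p = i}" by auto
      then show "?R ACC = 0 \<longleftrightarrow> {p \<in> lamps s. p < Suc i} = {}" using Suc.prems(5) by auto
    qed (use i Suc.prems in auto)
    moreover have "R' TEST \<noteq> 0" using Suc.prems i by simp
    ultimately show ?case
      using rel' Suc.prems by (intro wp_While_True) (auto simp: eval_nat_numeral)
  qed
  have "wp xs ?loop Q (t + 3) (R(ACC := 0, IDX := 0, TEST := n))"
  proof (rule loop[of 0])
    show "walk_rel L n a (s\<lparr>lamps := {p \<in> lamps s. 0 \<le> p}\<rparr>) (R(ACC := 0, IDX := 0, TEST := n))"
      using rel by (auto simp: walk_rel_def)
  qed auto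
  moreover have "R MODULUS = n" using rel by (simp add: walk_rel_def)
  ultimately show ?thesis by (simp add: clear_lamps_def eval_nat_numeral)
qed

section \<open>Enumeration of the conjugators\<close>

lemma balanced_digit_val:
  assumes "cs \<noteq> []" "digits_ok n (length cs) D" "digits_ok n (length cs) D'"
    "digit_val n D 2 (length cs - 1) = digit_val n D' 2 (length cs - 1)"
  shows "balanced n cs D \<longleftrightarrow> balanced n cs D'"
proof (rule balanced_cong)
  fix i assume i: "i \<in> {1..<Suc (length cs)}"
  have "2 + (length cs - 1) = Suc (length cs)" using assms(1) by (cases cs) auto
  with i digit_val_inj[OF assms(4), of i] assms(2,3) show "D i = D' i"
    by (cases "i = 1") (auto simp: digits_ok_def)
qed

text \<open>A carry that survives the whole word means that the odometer has overflowed and all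
  choices were tried; \<open>GO\<close> then becomes 0.\<close>

definition next_round :: com where
  "next_round = set_const CARRY 1 ;; set_const RADIX 1 ;; each_letter walk_body ;; clear_lamps ;;
     Cond ACC Skip (set_const ANS 1) ;; sub GO ONE CARRY"

definition search :: com where
  "search = set_const DIG 30 ;; set_const TMP 31 ;; add BASE TMP LEN ;; set_const GO 1 ;; While GO next_round"

locale conj_equation =
  fixes W pre :: "sym letter list" and cs :: "gen letter list list" and n :: nat
  assumes W: "W = pre @ conj_prod cs" and xy: "list_all is_xy pre" and cs: "cs \<noteq> []"
    and n: "0 < n" "n \<le> length W"
begin

abbreviation "k \<equiv> length cs"
abbreviation "val D \<equiv> digit_val n D 2 (k - 1)"
abbreviation "state a D p c r \<equiv>
  walk_rel (2 * length W) n a \<lparr>digits = D, lamps = {}, pos = p, carry = c, radix = r\<rparr>"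

lemma index_bound:
  assumes "Inv (Var (VarZ j)) \<in> set W"
  shows "j \<le> 2 * length W"
proof -
  have "Inv (Var (VarZ j)) \<notin> set pre" using xy by (auto simp: list_all_iff)
  then have "Inv (Var (VarZ j)) \<in> set (conj_prod_from 1 cs)" using assms W by (auto simp: conj_prod_eq)
  from kind_conj_prod_from(2)[OF this refl] have "j \<le> k" by simp
  also have "k \<le> length W" by (simp add: W conj_prod_eq length_conj_prod_from)
  finally show ?thesis by simp
qed

lemma wp_next_round:
  assumes st: "state a D p c r R" and D: "digits_ok n k D"
    and post: "\<And>u S D' p' c' r'. u \<le> t + 100 * length W \<Longrightarrow> digits_ok n k D' \<Longrightarrow> c' \<le> 1 \<Longrightarrow>
      val D' + c' * n ^ (k - 1) = val D + 1 \<Longrightarrow>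
      state (if balanced n cs D' then 1 else a) D' p' c' r' S \<Longrightarrow> S GO = 1 - c' \<Longrightarrow> Q u S"
  shows "wp (encode W) next_round Q t R"
proof -
  let ?s = "\<lparr>digits = D, lamps = {}, pos = p, carry = 1, radix = 1\<rparr>"
  define s' where "s' = fold (walk_letter n) W ?s"
  have s': "digits_ok n k (digits s')" "carry s' \<le> 1" "lamps s' \<subseteq> {..<n}"
    "val (digits s') + carry s' * n ^ (k - 1) = val D + 1" "lamps s' = {} \<longleftrightarrow> balanced n cs (digits s')"
    using walk_round[OF n(1) cs xy D s'_def[unfolded W]] by auto
  have init: "walk_rel (2 * length W) n a ?s (R(CARRY := 1, RADIX := 1))"
    using st by (auto simp: walk_rel_def)
  have "wp (encode W) (each_letter walk_body) (wp (encode W) (clear_lamps ;;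
     Cond ACC Skip (set_const ANS 1) ;; sub GO ONE CARRY) Q) (t + 2) (R(CARRY := 1, RADIX := 1))"
  proof (rule wp_each_letter[where rel = "walk_rel (2 * length W) n a" and f = "walk_letter n" and pot = "\<lambda>_. 0" and C = 60,
        OF _ _ _ init])
    fix l s t R assume "l \<in> set W" "walk_rel (2 * length W) n a s R" "R KIND = kind l" "R INDEX = index l"
    then show "wp (encode W) walk_body (\<lambda>u S. u + 0 \<le> t + 60 + 0 \<and> walk_rel (2 * length W) n a (walk_letter n l s) S
      \<and> S IDX = R IDX) t R"
      using index_bound by (intro wp_walk_body) auto
  next
    fix s R i v assume "i \<in> {1, IDX, KIND, INDEX, TEST}" "walk_rel (2 * length W) n a s R"
    then show "walk_rel (2 * length W) n a s (R(i := v))" by (rule walk_rel_frame)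
  next
    fix s R assume "walk_rel (2 * length W) n a s R"
    then show "R LEN = 2 * length W \<and> R ONE = 1" by (simp add: walk_rel_def)
  next
    fix u S assume u: "u + 0 \<le> t + 2 + 3 + (60 + 8) * length W + 0"
      and S: "walk_rel (2 * length W) n a (fold (walk_letter n) W ?s) S"
    have "wp (encode W) clear_lamps (wp (encode W) (Cond ACC Skip (set_const ANS 1) ;; sub GO ONE CARRY) Q) u S"
    proof (rule wp_clear_lamps[OF S[folded s'_def] s'(3)])
      fix v T assume v: "v \<le> u + 4 + 10 * n" and T: "walk_rel (2 * length W) n a (s'\<lparr>lamps := {}\<rparr>) T"
        and acc: "T ACC = 0 \<longleftrightarrow> lamps s' = {}"
      have c: "T CARRY = carry s'" "T ONE = 1" using T by (auto simp: walk_rel_def)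
      \<comment> \<open>The walk takes 68 steps per letter and the sweep 10 per lamp; the remaining
        22 per letter cover the constant overhead because the word is nonempty.\<close>
      have t_bound: "v + 4 \<le> t + 100 * length W" using u v n by (simp add: Suc_le_eq[symmetric])
      show "wp (encode W) (Cond ACC Skip (set_const ANS 1) ;; sub GO ONE CARRY) Q v T"
      proof (cases "T ACC = 0")
        case True
        have "Q (v + 3) (T(ANS := 1, GO := 1 - carry s'))"
          by (rule post[of _ "digits s'" "carry s'" "pos s'" "radix s'"])
            (use t_bound s' T acc True in \<open>auto simp: walk_rel_def\<close>)
        with True c show ?thesis by (simp add: eval_nat_numeral)
      next
        case False
        have "Q (v + 4) (T(1 := 0, GO := 1 - carry s'))"
          by (rule post[of _ "digits s'" "carry s'" "pos s'" "radix s'"])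
            (use t_bound s' T acc False in \<open>auto simp: walk_rel_def\<close>)
        with False c show ?thesis by (simp add: eval_nat_numeral)
      qed
    qed
    then show "wp (encode W) (clear_lamps ;; Cond ACC Skip (set_const ANS 1) ;; sub GO ONE CARRY) Q u S" by simp
  qed
  then show ?thesis by (simp add: next_round_def eval_nat_numeral)
qed

text \<open>A round tests the vector reached after the increment, so the start vector is not tested
  at once; the overflow at the end leads back to value 0. Started at 0, the search meets every
  vector, the zero vector last.\<close>

lemma wp_enumerate:
  assumes "state a D p c r R" "digits_ok n k D" "R GO = 1" "a \<le> 1"
    and "\<And>u S. u \<le> t + 1 + (n ^ (k - 1) - val D) * (103 * length W) \<Longrightarrow>
      S ANS = (if a = 1 \<or> (\<exists>D'. digits_ok n k D' \<and> balanced n cs D' \<and> (val D < val D' \<or> val D' = 0)) then 1 else 0) \<Longrightarrow>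
      Q u S"
  shows "wp (encode W) (While GO next_round) Q t R"
  using assms
proof (induction "n ^ (k - 1) - val D" arbitrary: a D p c r R t rule: less_induct)
  case less
  have val_less: "val D' < n ^ (k - 1)" if "digits_ok n k D'" for D'
  proof -
    have "2 + (k - 1) = Suc k" using cs by (cases cs) auto
    with that show ?thesis by (intro digit_val_less) (auto simp: digits_ok_def)
  qed
  have len: "length W \<ge> 1" using n by simp
  show ?case
  proof (rule wp_While_True)
    show "R GO \<noteq> 0" using less.prems by simp
    show "wp (encode W) next_round (\<lambda>u S. wp (encode W) (While GO next_round) Q (u + 2) (S(1 := 0))) (Suc t) R"
    proof (rule wp_next_round[OF less.prems(1,2)])
      fix u S D' p' c' r'
      let ?a = "if balanced n cs D' then 1 else a"
      assume u: "u \<le> Suc t + 100 * length W" and D': "digits_ok n k D'" and c': "c' \<le> 1"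
        and val: "val D' + c' * n ^ (k - 1) = val D + 1" and S: "state ?a D' p' c' r' S" and go: "S GO = 1 - c'"
      have S': "state ?a D' p' c' r' (S(1 := 0))" using S by (intro walk_rel_frame) auto
      have same: "balanced n cs E \<longleftrightarrow> balanced n cs D'" if "digits_ok n k E" "val E = val D'" for E
        using balanced_digit_val[OF cs that(1) D' that(2)] .
      \<comment> \<open>Three steps of loop control per round raise the factor from 100 to
        103.\<close>
      have bound: "u + 3 + (n ^ (k - 1) - (val D + 1)) * (103 * length W) \<le> t + 1 + (n ^ (k - 1) - val D) * (103 * length W)"
      proof -
        have "n ^ (k - 1) - val D = (n ^ (k - 1) - (val D + 1)) + 1" using val_less[OF less.prems(2)] by simp
        then show ?thesis using u len by (simp add: algebra_simps)
      qed
      show "wp (encode W) (While GO next_round) Q (u + 2) (S(1 := 0))"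
      proof (cases "c' = 0")
        case True
        then have v: "val D' = val D + 1" using val by simp
        show ?thesis
        proof (rule less.hyps[OF _ S' D'])
          show "n ^ (k - 1) - val D' < n ^ (k - 1) - val D" unfolding v using val_less[OF less.prems(2)] by linarith
          show "(S(1 := 0)) GO = 1" using go True by simp
          show "?a \<le> 1" using less.prems(4) by simp
        next
          fix u' and T :: "nat \<Rightarrow> nat" assume u': "u' \<le> u + 2 + 1 + (n ^ (k - 1) - val D') * (103 * length W)"
            and T: "T ANS = (if ?a = 1 \<or> (\<exists>E. digits_ok n k E \<and> balanced n cs E \<and> (val D' < val E \<or> val E = 0)) then 1 else 0)"
          show "Q u' T"
          proof (rule less.prems(5))
            show "u' \<le> t + 1 + (n ^ (k - 1) - val D) * (103 * length W)" using u' v bound by simp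
            have "(?a = 1 \<or> (\<exists>E. digits_ok n k E \<and> balanced n cs E \<and> (val D' < val E \<or> val E = 0))) \<longleftrightarrow>
              (a = 1 \<or> (\<exists>E. digits_ok n k E \<and> balanced n cs E \<and> (val D < val E \<or> val E = 0)))"
            proof (cases "balanced n cs D'")
              case True
              then show ?thesis using D' v by auto
            next
              case False
              then have "val E \<noteq> val D'" if "digits_ok n k E" "balanced n cs E" for E
                using same that by blast
              then have "val D' < val E \<longleftrightarrow> val D < val E" if "digits_ok n k E" "balanced n cs E" for E
                using that v by fastforce
              with False show ?thesis by auto
            qed
            then show "T ANS = (if a = 1 \<or> (\<exists>E. digits_ok n k E \<and> balanced n cs E \<and> (val D < val E \<or> val E = 0)) then 1 else 0)"
              unfolding T by simp
          qed
        qed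
      next
        case False
        then have "c' = 1" using c' by simp
        with val have "val D' + n ^ (k - 1) = val D + 1" by simp
        then have v: "val D' = 0" "n ^ (k - 1) = val D + 1"
          using val_less[OF less.prems(2)] by linarith+
        have "Q (Suc (u + 2)) (S(1 := 0))"
        proof (rule less.prems(5))
          show "Suc (u + 2) \<le> t + 1 + (n ^ (k - 1) - val D) * (103 * length W)" using bound by simp
          have "(\<exists>E. digits_ok n k E \<and> balanced n cs E \<and> (val D < val E \<or> val E = 0)) \<longleftrightarrow> balanced n cs D'"
            using val_less v D' same by (metis Suc_eq_plus1 not_less_eq)
          moreover have "S ANS = ?a" using S by (simp add: walk_rel_def)
          ultimately show "(S(1 := 0)) ANS = (if a = 1 \<or> (\<exists>E. digits_ok n k E \<and> balanced n cs E \<and> (val D < val E \<or> val E = 0)) then 1 else 0)"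
            using less.prems(4) by auto
        qed
        then show ?thesis using go False c' by (intro wp_While_False) auto
      qed
    qed
  qed
qed

lemma wp_search:
  assumes R: "R ANS = 0" "R LEN = 2 * length W" "R ONE = 1" "R MODULUS = n" "\<And>i. i \<ge> 26 \<Longrightarrow> R i = 0"
    and post: "\<And>u S. u \<le> t + 5 + n ^ (k - 1) * (103 * length W) \<Longrightarrow>
      S ANS = (if \<exists>D. digits_ok n k D \<and> balanced n cs D then 1 else 0) \<Longrightarrow> Q u S"
  shows "wp (encode W) search Q t R"
proof -
  let ?R = "R(DIG := 30, TMP := 31, BASE := 31 + 2 * length W, GO := 1)"
  have "wp (encode W) (While GO next_round) Q (t + 4) ?R"
  proof (rule wp_enumerate)
    show "state 0 (\<lambda>_. 0) (R POS) (R CARRY) (R RADIX) ?R"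
      using R by (auto simp: walk_rel_def)
    show "digits_ok n k (\<lambda>_. 0)" using n by (simp add: digits_ok_def)
  next
    fix u and S :: "nat \<Rightarrow> nat"
    assume u: "u \<le> t + 4 + 1 + (n ^ (k - 1) - val (\<lambda>_. 0)) * (103 * length W)"
      and S: "S ANS = (if (0::nat) = 1 \<or> (\<exists>D'. digits_ok n k D' \<and> balanced n cs D' \<and> (val (\<lambda>_. 0) < val D' \<or> val D' = 0)) then 1 else 0)"
    show "Q u S"
    proof (rule post)
      show "u \<le> t + 5 + n ^ (k - 1) * (103 * length W)" using u by simp
      show "S ANS = (if \<exists>D. digits_ok n k D \<and> balanced n cs D then 1 else 0)"
        unfolding S digit_val_zero by (metis neq0_conv zero_neq_one)
    qed
  qed auto
  then show ?thesis using R by (simp add: search_def eval_nat_numeral)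
qed

end

section \<open>The complete algorithm\<close>

definition is_pos_x :: "nat \<Rightarrow> nat \<Rightarrow> com" where
  "is_pos_x r a = set_const TMP a ;; Instr (InRead TMP2 TMP) ;; set_const TMP 4 ;; sub M TMP2 TMP ;;
     sub TMP TMP TMP2 ;; add M M TMP ;; sub r ONE M"

lemma wp_is_pos_x:
  assumes "R ONE = 1"
    and "\<And>S. S r = (if input_at xs a = 4 then 1 else 0) \<Longrightarrow> (\<forall>i. i \<notin> {r, TMP, TMP2, M} \<longrightarrow> S i = R i) \<Longrightarrow> Q (t + 7) S"
  shows "wp xs (is_pos_x r a) Q t R"
proof -
  let ?v = "input_at xs a" and ?S = "R(TMP2 := input_at xs a, TMP := 4 - input_at xs a)"
  have "Q (t + 7) (?S(M := (?v - 4) + (4 - ?v), r := 1 - ((?v - 4) + (4 - ?v))))"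
    by (rule assms(2)) auto
  then show ?thesis using assms(1) by (simp add: is_pos_x_def eval_nat_numeral)
qed

text \<open>The first test leaves the contribution of the prefix, 0 or 1, in \<open>MODULUS\<close>,
  so that the gcd of the scan starts from it.\<close>

definition prepare :: com where
  "prepare = is_pos_x MODULUS 4 ;; is_pos_x FREE 0 ;; each_letter scan_body ;;
     sub TMP UPS DOWNS ;; sub TMP2 DOWNS UPS ;; add ACC TMP TMP2 ;; Cond FREE halve_loop (set_const M 0)"

text \<open>A final \<open>ACC\<close> of 0 says exactly that the displacements can be made to
  cancel, and \<open>M\<close> is then the required absolute value of \<open>d\<close>. The term
  \<open>7 * S MODULUS\<close> is credit for the last gcd.\<close>

lemma wp_prepare:
  assumes W: "W = pre @ conj_prod cs" and xy: "list_all is_xy pre"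
    and R: "R LEN = 2 * length W" "R ONE = 1" "R UP = 0" "R DOWN = 0" "R UPS = 0" "R DOWNS = 0"
    and s: "int s = \<bar>sum_list (map delta cs)\<bar>" and free: "free \<longleftrightarrow> input_at (encode W) 0 = 4"
    and post: "\<And>u S. u + 7 * S MODULUS \<le> t + 50 + 78 * length W + 6 * s \<Longrightarrow>
      int (S MODULUS) = gcd (if input_at (encode W) 4 = 4 then 1 else 0) (gcds cs) \<Longrightarrow>
      S M = (if free then (s + 1) div 2 else 0) \<Longrightarrow> S ACC = (if free then s mod 2 else s) \<Longrightarrow>
      (\<forall>i. i \<notin> insert ACC (insert FREE scan_regs) \<longrightarrow> S i = R i) \<Longrightarrow> Q u S"
  shows "wp (encode W) prepare Q t R"
proof -
  let ?x = "encode W"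
  define n0 :: nat where "n0 = (if input_at ?x 4 = 4 then 1 else 0)"
  let ?rest = "sub TMP UPS DOWNS ;; sub TMP2 DOWNS UPS ;; add ACC TMP TMP2 ;; Cond FREE halve_loop (set_const M 0)"
  have "wp ?x (is_pos_x MODULUS 4) (wp ?x (is_pos_x FREE 0) (wp ?x (each_letter scan_body) (wp ?x ?rest Q))) t R"
  proof (rule wp_is_pos_x[where R = R, OF R(2)], rule wp_is_pos_x)
    fix S1 S2
    assume 1: "S1 MODULUS = (if input_at ?x 4 = 4 then 1 else 0)" "\<forall>i. i \<notin> {MODULUS, TMP, TMP2, M} \<longrightarrow> S1 i = R i"
      and 2: "S2 FREE = (if input_at ?x 0 = 4 then 1 else 0)" "\<forall>i. i \<notin> {FREE, TMP, TMP2, M} \<longrightarrow> S2 i = S1 i"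
    obtain g P Q' where fold: "fold scan_letter W (n0, 0, 0, 0, 0) = (g, 0, 0, P, Q')"
      and g: "int g = gcd (int n0) (gcds cs)" and PQ: "int P - int Q' = sum_list (map delta cs)"
      using scan_conj_prod_from[of 1 cs n0 0 0] by (auto simp: W fold_scan_xy[OF xy] conj_prod_eq)
    have ac: "(P - Q') + (Q' - P) = s" using PQ s by linarith
    show "wp ?x (each_letter scan_body) (wp ?x ?rest Q) (t + 7 + 7) S2"
    proof (rule wp_each_letter[where rel = "scan_rel S2" and f = scan_letter and pot = scan_pot and C = 70 and s = "(n0, 0, 0, 0, 0)"])
      fix l s t R' assume "scan_rel S2 s R'" "R' KIND = kind l"
      then show "wp ?x scan_body (\<lambda>u S. u + scan_pot (scan_letter l s) \<le> t + 70 + scan_pot s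
        \<and> scan_rel S2 (scan_letter l s) S \<and> S IDX = R' IDX) t R'"
        using 1 2 R by (intro wp_scan_body) auto
    next
      fix s R' i v assume "i \<in> {1, IDX, KIND, INDEX, TEST}" "scan_rel S2 s R'"
      then show "scan_rel S2 s (R'(i := v))" by (rule scan_rel_frame)
    next
      fix s R' assume "scan_rel S2 s R'"
      then show "R' LEN = 2 * length W \<and> R' ONE = 1" using 1 2 R by (cases s) (auto simp: scan_regs_def)
    next
      show "scan_rel S2 (n0, 0, 0, 0, 0) S2" using 1 2 R by (auto simp: n0_def)
    next
      fix u S assume u: "u + scan_pot (fold scan_letter W (n0, 0, 0, 0, 0)) \<le> t + 7 + 7 + 3 + (70 + 8) * length W + scan_pot (n0, 0, 0, 0, 0)"
        and S: "scan_rel S2 (fold scan_letter W (n0, 0, 0, 0, 0)) S"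
      have u': "u + 7 * g \<le> t + 24 + 78 * length W" using u unfolding fold scan_pot.simps by (simp add: n0_def split: if_splits)
      have r: "S MODULUS = g" "S UPS = P" "S DOWNS = Q'" "S FREE = (if free then 1 else 0)" "S ONE = 1"
        and fr: "\<And>i. i \<notin> insert ACC (insert FREE scan_regs) \<Longrightarrow> S i = R i"
        using S 1 2 free R(2) by (auto simp: fold scan_regs_def)
      have g': "int g = gcd (if input_at ?x 4 = 4 then 1 else 0) (gcds cs)" using g by (simp add: n0_def)
      let ?S = "S(TMP := P - Q', TMP2 := Q' - P, ACC := s)"
      have "wp ?x (Cond FREE halve_loop (set_const M 0)) Q (u + 3) ?S"
      proof (cases free)
        case True
        have "wp ?x halve_loop (\<lambda>u S. Q (u + 2) (S(1 := 0))) (u + 4) ?S"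
        proof (rule wp_halve_loop)
          fix v T assume v: "v \<le> u + 4 + 10 + 6 * ?S ACC" and T: "T M = (?S ACC + 1) div 2" "T ACC = ?S ACC mod 2"
            "\<forall>i. i \<notin> {1, TMP, M, TEST, ACC} \<longrightarrow> T i = ?S i"
          show "Q (v + 2) (T(1 := 0))"
            by (rule post) (use u' v T r g' True fr in \<open>auto simp: scan_regs_def\<close>)
        qed (use r in simp)
        then show ?thesis using True r by (simp add: eval_nat_numeral)
      next
        case False
        have "Q (u + 5) (?S(M := 0))"
          by (rule post) (use u' r g' False fr in \<open>auto simp: scan_regs_def\<close>)
        then show ?thesis using False r by (simp add: eval_nat_numeral)
      qed
      then show "wp ?x ?rest Q u S" using r ac by (simp add: eval_nat_numeral)
    qed
  qed (use R in auto)
  then show ?thesis unfolding prepare_def wp_Seq_fun .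
qed

text \<open>If the gcd vanishes, the modulus becomes the length of the word. The input has twice as
  many cells, so \<open>LEN\<close> is halved, by way of \<open>ACC\<close>, which is 0 at that
  point.\<close>

definition solver :: com where
  "solver = set_const ONE 1 ;; Instr (InLength LEN) ;; set_const TMP 2 ;; sub TMP LEN TMP ;; Instr (InRead KIND TMP) ;;
     set_const TMP2 7 ;; sub TEST KIND TMP2 ;;
     Cond TEST
       (prepare ;;
        Cond ACC Skip
          (gcd_loop ;;
           Cond MODULUS Skip (add ACC ACC LEN ;; halve_loop ;; add MODULUS MODULUS M) ;;
           search))
       (set_const ANS 1)"

text \<open>For \<open>k \<ge> 1\<close> and \<open>L = length W\<close>, at most
  \<open>80 + 110 * L\<close> steps precede the search, which takes \<open>103 * L^k\<close> and a
  few more; as \<open>1 \<le> L \<le> L^k\<close>, the factor 310 suffices.\<close>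

lemma wp_solver:
  assumes quad: "quadratic_lhs W k"
  shows "wp (encode W) solver (\<lambda>u S. u \<le> 310 * length W ^ k \<and> S 0 = (if solvable W then 1 else 0)) 0 (\<lambda>_. 0)"
proof -
  let ?x = "encode W"
  let ?Q = "\<lambda>u S. u \<le> 310 * length W ^ k \<and> S 0 = (if solvable W then 1 else (0::nat))"
  have last: "input_at ?x (2 * length W - 2) = kind (last W)" if "W \<noteq> []"
  proof -
    have "2 * length W - 2 = 2 * (length W - 1)" by simp
    with that show ?thesis by (simp add: input_at_encode last_conv_nth)
  qed
  show ?thesis
  proof (cases "k = 0")
    case True
    then have W: "solvable W" "W \<noteq> []" "kind (last W) < 8" using solvable_no_constants quad by auto
    then have "kind (last W) - 7 = 0" by simp
    \<comment> \<open>Only the last letter is read, so the number of steps is a constant.\<close>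
    with True W last show ?thesis
      by (simp add: solver_def length_encode eval_nat_numeral)
  next
    case False
    obtain pre cs where W: "W = pre @ conj_prod cs" and k: "length cs = k" and xy: "list_all is_xy pre"
      and pre: "vars pre \<inter> range VarZ = {}"
        "vals pre = {(2 * d, F) |d F. d \<in> (if input_at ?x 0 = 4 then UNIV else {0})
          \<and> F \<in> bdry (gcd (if input_at ?x 4 = 4 then 1 else 0) d)}"
      by (rule quadratic_lhs_cases[OF quad])
    have cs: "cs \<noteq> []" using k False by auto
    define free where "free \<longleftrightarrow> input_at ?x 0 = 4"
    define n0 :: int where "n0 = (if input_at ?x 4 = 4 then 1 else 0)"
    define s where "s = nat \<bar>sum_list (map delta cs)\<bar>"
    have s: "int s = \<bar>sum_list (map delta cs)\<bar>" by (simp add: s_def)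
    define L where "L = length W"
    have "sum_list (map (\<lambda>c. length c + 1) cs) < length W"
      using cs by (simp add: W conj_prod_eq length_conj_prod_from)
    then have s_le: "s < L" using abs_sum_delta_le[of cs] s unfolding L_def by linarith
    have pow: "L * L ^ (k - 1) = L ^ k" using False by (cases k) auto
    have L_le: "L \<le> L ^ k" "1 \<le> L" using False s_le by (auto intro: self_le_power)
    have Wne: "W \<noteq> []" using s_le by (auto simp: L_def)
    have last8: "kind (last W) = 8" using kind_last_conj_prod[OF cs] W by simp
    let ?R = "(\<lambda>_. 0)(ONE := 1, LEN := 2 * L, TMP := 2 * L - 2, KIND := 8, TMP2 := 7, TEST := (1::nat))"
    let ?search = "gcd_loop ;; Cond MODULUS Skip (add ACC ACC LEN ;; halve_loop ;; add MODULUS MODULUS M) ;; search"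
    let ?Q2 = "\<lambda>u S. ?Q (u + 2) (S(1 := 0))"
    have "wp ?x prepare (wp ?x (Cond ACC Skip ?search) ?Q2) 8 ?R"
    proof (rule wp_prepare[OF W xy _ _ _ _ _ _ s free_def])
      fix u S
      assume u: "u + 7 * S MODULUS \<le> 8 + 50 + 78 * length W + 6 * s"
        and g: "int (S MODULUS) = gcd (if input_at ?x 4 = 4 then 1 else 0) (gcds cs)"
        and h: "S M = (if free then (s + 1) div 2 else 0)" and r: "S ACC = (if free then s mod 2 else s)"
        and fr: "\<forall>i. i \<notin> insert ACC (insert FREE scan_regs) \<longrightarrow> S i = ?R i"
      define h' where "h' = (if free then s div 2 else 0)"
      define n where "n = (if gcd (S MODULUS) h' = 0 then length W else gcd (S MODULUS) h')"
      note crit = solvable_iff_digits[OF W cs pre(1) pre(2)[folded free_def n0_def] _ g[folded n0_def] s h'_def n_def]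
      have n: "0 < n" "n \<le> length W"
        and sol: "solvable W \<longleftrightarrow> (if free then even s else s = 0) \<and> (\<exists>D. digits_ok n (length cs) D \<and> balanced n cs D)"
        using crit by (auto simp: n0_def)
      have R: "S ANS = 0" "S LEN = 2 * L" "S ONE = 1" "\<And>i. i \<ge> 26 \<Longrightarrow> S i = 0"
        using fr by (auto simp: scan_regs_def)
      have u': "u + 7 * S MODULUS \<le> 58 + 84 * L" using u s_le by (simp add: L_def)
      show "wp ?x (Cond ACC Skip ?search) ?Q2 u S"
      proof (cases "S ACC = 0")
        case False
        then have "\<not> solvable W" using r unfolding sol by (auto split: if_splits)
        moreover have "u + 5 \<le> 310 * L ^ k" using u' L_le by linarith
        ultimately show ?thesis using False R by (simp add: L_def)
      next
        case True
        then have par: "if free then even s else s = 0" using r by (auto split: if_splits)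
        \<comment> \<open>Rounding up and rounding down agree for even \<open>s\<close>.\<close>
        then have M: "S M = h'" using h by (auto simp: h'_def)
        have h_le: "h' \<le> L" using s_le by (auto simp: h'_def)
        interpret conj_equation W pre cs n
          by unfold_locales (use W xy cs n in auto)
        have fin: "wp ?x search ?Q2 v T"
          if v: "v \<le> 80 + 110 * L" and T: "T MODULUS = n" "\<And>i. i \<notin> {1, TMP, TEST, MODULUS, M, TMP2, ACC} \<Longrightarrow> T i = S i" for v T
        proof (rule wp_search)
          fix w and U :: "nat \<Rightarrow> nat"
          assume w: "w \<le> v + 5 + n ^ (length cs - 1) * (103 * length W)"
            and U: "U ANS = (if \<exists>D. digits_ok n (length cs) D \<and> balanced n cs D then 1 else 0)"
          \<comment> \<open>The bound \<open>n \<le> L\<close> limits the search to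
            \<open>L^(k-1)\<close> rounds of \<open>103 * L\<close> steps.\<close>
          have "n ^ (k - 1) * (103 * L) \<le> L ^ (k - 1) * (103 * L)"
            using n by (intro mult_right_mono power_mono) (auto simp: L_def)
          also have "\<dots> = 103 * L ^ k" using pow by (simp add: ac_simps)
          finally have "w + 2 \<le> 310 * L ^ k" using w v L_le unfolding k L_def by linarith
          then show "?Q2 w U" using U sol par by (simp add: L_def)
        qed (use T R in \<open>auto simp: L_def\<close>)
        have "wp ?x gcd_loop (wp ?x (Cond MODULUS Skip (add ACC ACC LEN ;; halve_loop ;; add MODULUS MODULUS M) ;; search) ?Q2)
          (Suc u) S"
        proof (rule wp_gcd_loop)
          fix v T assume v: "v + 7 * T MODULUS \<le> Suc u + 1 + 7 * (S MODULUS + 2 * S M)"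
            and T: "T MODULUS = gcd (S MODULUS) (S M)" "\<forall>i. i \<notin> {1, TMP, MODULUS, M, TMP2} \<longrightarrow> T i = S i"
          have v': "v \<le> 60 + 98 * L" using v u' h_le unfolding M distrib_left by simp
          show "wp ?x (Cond MODULUS Skip (add ACC ACC LEN ;; halve_loop ;; add MODULUS MODULUS M) ;; search) ?Q2 v T"
          proof (cases "T MODULUS = 0")
            case False
            then have "n = T MODULUS" using T(1) unfolding n_def M[symmetric] by (metis (full_types))
            then have "wp ?x search ?Q2 (v + 3) (T(1 := 0))"
              by (intro fin) (use v' T in auto)
            then show ?thesis using False by (simp add: eval_nat_numeral)
          next
            case zero: True
            then have nL: "n = L" using T(1) unfolding n_def L_def M[symmetric] by (metis (full_types))
            have "wp ?x halve_loop (wp ?x (add MODULUS MODULUS M) (wp ?x search ?Q2)) (v + 2) (T(ACC := 2 * L))"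
            proof (rule wp_halve_loop)
              fix w U assume w: "w \<le> v + 2 + 10 + 6 * (T(ACC := 2 * L)) ACC"
                and U: "U M = ((T(ACC := 2 * L)) ACC + 1) div 2"
                  "\<forall>i. i \<notin> {1, TMP, M, TEST, ACC} \<longrightarrow> U i = (T(ACC := 2 * L)) i"
              have "wp ?x search ?Q2 (Suc w) (U(MODULUS := L))"
                by (rule fin) (use v' w U T nL in auto)
              moreover have "U MODULUS + U M = L" using U zero by simp
              ultimately show "wp ?x (add MODULUS MODULUS M) (wp ?x search ?Q2) w U" by simp
            qed (use T R in auto)
            moreover have "T ACC + T LEN = 2 * L" using T True R by simp
            ultimately show ?thesis using zero by (simp add: eval_nat_numeral)
          qed
        qed
        then show ?thesis using True by simp
      qed
    qed (simp_all add: L_def)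
    then show ?thesis
      using last[OF Wne] last8 by (simp add: solver_def length_encode L_def eval_nat_numeral)
  qed
qed

theorem corollary6p1:
  "\<exists>(P :: instr list) (C :: nat). \<forall>W k. quadratic_lhs W k \<longrightarrow>
     answers_within P (encode W) (C * length W ^ k) (solvable W)"
  by (intro exI[of _ "compile 0 solver"] exI[of _ 310] allI impI answers_within_compile wp_solver)

end
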